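(* Let $T\in(0,1]$, $I=[-T,T]$, and let $H_{m,M}$ be the Green's function of the periodic problem $$v''(t)+m\,v(-t)+M\,v([t])=\sigma(t)\ \text{ a.e. } t\in I,\qquad v(T)=v(-T),\quad v'(-T)=v'(T).$$ Suppose that $m\geq 0$, $M\geq 0$ and $m+M>0$. Then $H_{m,M}$ is positive if, and only if, $M\in(-m,\lambda_1)$, where $$\lambda_1=\frac{m}{-1+\sec(\sqrt{m}\,T)}$$ is the first Dirichlet eigenvalue of the problem $$z''(t)=-m\,z(-t)-M\,z([t]),\quad t\in I,\qquad z(-T)=z(T)=0.$$
   Context: Here $m,M$ are real constants and $\sigma\in\mathcal{L}^1(I)$. The function $[t]$ is truncation towards zero: for $n\in\{0,1,2,\ldots\}$, $[t]=n$ if $t\in[n,n+1)$ and $[t]=-n$ if $t\in(-n-1,-n]$. A solution of the periodic problem is a function $v\in C^1(I)$ with $v'$ absolutely continuous on $I$, whose second derivative $v''$ exists and is continuous on $I$ if $T<1$ (continuous on $[-1,1)$ with a finite left limit at $1$ if $T=1$), and which satisfies the equation and the boundary conditions. The Green's function $H_{m,M}:I\times I\to\mathbb{R}$ is the continuous kernel such that, whenever the periodic problem has a unique solution $v$, it is given by $v(t)=\int_{-T}^{T}H_{m,M}(t,s)\,\sigma(s)\,ds$. Positive means $>0$ at every point of $I\times I$. A Dirichlet eigenvalue of the problem for $z$ is a value of the parameter $M$ (with $m$ and $T$ fixed) for which that problem has a nontrivial solution $z$ of class $C^1(I)$; the first one is the smallest positive one.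
   Formalization: The equivalence fails for large m (T=1, m=36, M=0), so √m·T<π/2 is added to the right-hand side; λ₁ is claimed to be the first Dirichlet eigenvalue only if m=0 or 0<cos(√m T)<1, where it is defined and positive; at m=0 λ₁ is read as its limit 2/T². *)

theory Defs
  imports "HOL-Analysis.Analysis"
begin

definition trunc :: "real \<Rightarrow> real" where
  "trunc t = (if 0 \<le> t then of_int \<lfloor>t\<rfloor> else of_int \<lceil>t\<rceil>)"

text \<open>The epsilon-delta notion for functions; the library's \<open>absolutely_continuous\<close> concerns
  measures.\<close>

definition abs_continuous_on :: "real \<Rightarrow> real \<Rightarrow> (real \<Rightarrow> real) \<Rightarrow> bool" where
  "abs_continuous_on a b f \<longleftrightarrow>
    (\<forall>\<epsilon>>0. \<exists>\<delta>>0. \<forall>(n::nat) x y.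
      (\<forall>i<n. a \<le> x i \<and> x i \<le> y i \<and> y i \<le> b) \<and>
      (\<forall>i<n. \<forall>j<n. i \<noteq> j \<longrightarrow> y i \<le> x j \<or> y j \<le> x i) \<and>
      (\<Sum>i<n. y i - x i) < \<delta>
      \<longrightarrow> (\<Sum>i<n. \<bar>f (y i) - f (x i)\<bar>) < \<epsilon>)"

text \<open>\<open>v1\<close> and \<open>v2\<close> are the first and second derivatives of \<open>v\<close> on \<open>[-T, T]\<close>, one-sided at the
  end points. For \<open>T = 1\<close> the function \<open>trunc\<close> jumps at the right end point, so \<open>v2\<close> is only
  required to be continuous on \<open>[-1, 1)\<close> with a finite left limit at 1.\<close>

definition admissible :: "real \<Rightarrow> (real \<Rightarrow> real) \<Rightarrow> (real \<Rightarrow> real) \<Rightarrow> (real \<Rightarrow> real) \<Rightarrow> bool" where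
  "admissible T v v1 v2 \<longleftrightarrow>
    (\<forall>t\<in>{-T..T}. (v has_real_derivative v1 t) (at t within {-T..T})) \<and>
    continuous_on {-T..T} v1 \<and>
    abs_continuous_on (-T) T v1 \<and>
    (if T < 1 then
       (\<forall>t\<in>{-T..T}. (v1 has_real_derivative v2 t) (at t within {-T..T})) \<and>
       continuous_on {-T..T} v2
     else
       (\<forall>t\<in>{-T..<T}. (v1 has_real_derivative v2 t) (at t within {-T..T})) \<and>
       continuous_on {-T..<T} v2 \<and>
       (\<exists>L. (v2 \<longlongrightarrow> L) (at_left T)))"

definition solves_equation ::
  "real \<Rightarrow> real \<Rightarrow> real \<Rightarrow> (real \<Rightarrow> real) \<Rightarrow> (real \<Rightarrow> real) \<Rightarrow> (real \<Rightarrow> real) \<Rightarrow> bool" where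
  "solves_equation T m M \<sigma> v v2 \<longleftrightarrow>
    (AE t in lebesgue_on {-T..T}. v2 t + m * v (-t) + M * v (trunc t) = \<sigma> t)"

definition periodic_solution ::
  "real \<Rightarrow> real \<Rightarrow> real \<Rightarrow> (real \<Rightarrow> real) \<Rightarrow> (real \<Rightarrow> real) \<Rightarrow> bool" where
  "periodic_solution T m M \<sigma> v \<longleftrightarrow>
    (\<exists>v1 v2. admissible T v v1 v2 \<and> solves_equation T m M \<sigma> v v2 \<and>
      v T = v (-T) \<and> v1 (-T) = v1 T)"

text \<open>Functions on \<open>[-T, T]\<close> are represented by total functions whose values outside are
  irrelevant, hence uniqueness is agreement on \<open>[-T, T]\<close>.\<close>

definition unique_periodic_solution ::
  "real \<Rightarrow> real \<Rightarrow> real \<Rightarrow> (real \<Rightarrow> real) \<Rightarrow> (real \<Rightarrow> real) \<Rightarrow> bool" where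
  "unique_periodic_solution T m M \<sigma> v \<longleftrightarrow>
    periodic_solution T m M \<sigma> v \<and>
    (\<forall>w. periodic_solution T m M \<sigma> w \<longrightarrow> (\<forall>t\<in>{-T..T}. w t = v t))"

text \<open>The second conjunct says that the homogeneous problem has only the trivial solution.
  Otherwise no right-hand side has a unique solution, the third conjunct is vacuous, and there is
  no Green's function.\<close>

definition greens_function :: "real \<Rightarrow> real \<Rightarrow> real \<Rightarrow> (real \<Rightarrow> real \<Rightarrow> real) \<Rightarrow> bool" where
  "greens_function T m M H \<longleftrightarrow>
    continuous_on ({-T..T} \<times> {-T..T}) (\<lambda>(t, s). H t s) \<and>
    unique_periodic_solution T m M (\<lambda>_. 0) (\<lambda>_. 0) \<and>
    (\<forall>\<sigma> v. \<sigma> absolutely_integrable_on {-T..T} \<and> unique_periodic_solution T m M \<sigma> v \<longrightarrow>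
      (\<forall>t\<in>{-T..T}. v t = integral {-T..T} (\<lambda>s. H t s * \<sigma> s)))"

definition positive_kernel :: "real \<Rightarrow> (real \<Rightarrow> real \<Rightarrow> real) \<Rightarrow> bool" where
  "positive_kernel T H \<longleftrightarrow> (\<forall>t\<in>{-T..T}. \<forall>s\<in>{-T..T}. 0 < H t s)"

text \<open>The equation is again read almost everywhere: for \<open>T = 1\<close> it cannot be imposed at the end
  points, where \<open>z (trunc t)\<close> jumps from \<open>z 0\<close> to 0.\<close>

definition dirichlet_eigenvalue :: "real \<Rightarrow> real \<Rightarrow> real \<Rightarrow> bool" where
  "dirichlet_eigenvalue T m M \<longleftrightarrow>
    (\<exists>z z1 z2. admissible T z z1 z2 \<and> solves_equation T m M (\<lambda>_. 0) z z2 \<and>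
      z (-T) = 0 \<and> z T = 0 \<and> (\<exists>t\<in>{-T..T}. z t \<noteq> 0))"

definition first_dirichlet_eigenvalue :: "real \<Rightarrow> real \<Rightarrow> real \<Rightarrow> bool" where
  "first_dirichlet_eigenvalue T m l \<longleftrightarrow>
    0 < l \<and> dirichlet_eigenvalue T m l \<and>
    (\<forall>\<mu>. 0 < \<mu> \<and> dirichlet_eigenvalue T m \<mu> \<longrightarrow> l \<le> \<mu>)"

text \<open>At \<open>m = 0\<close> the formula \<open>m / (-1 + sec (sqrt m * T))\<close> reads 0/0 and stands for its limit
  \<open>2 / T\<^sup>2\<close>. For \<open>m > 0\<close> it is a well-defined positive number exactly if
  \<open>0 < cos (sqrt m * T) < 1\<close>; otherwise there is no positive Dirichlet eigenvalue.

  If \<open>sqrt m * T\<close> is at least \<open>pi / 2\<close>, the Green's function is never positive: for \<open>m > 0\<close>,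
  \<open>H 0 s\<close> is a multiple of \<open>cos (sqrt m * (T - \<bar>s\<bar>))\<close>. But \<open>lambda1 T m\<close> becomes positive again
  beyond \<open>3 * pi / 2\<close> (for instance \<open>T = 1\<close>, \<open>m = 36\<close>), so \<open>M < lambda1 T m\<close> characterises
  positivity only together with \<open>sqrt m * T < pi / 2\<close>.\<close>

definition lambda1 :: "real \<Rightarrow> real \<Rightarrow> real" where
  "lambda1 T m = (if m = 0 then 2 / T\<^sup>2 else m / (-1 + 1 / cos (sqrt m * T)))"

end

theory Submission
  imports Defs
begin

text \<open>On \<open>[-T, T]\<close> \<open>[t] = 0\<close> almost everywhere, so the equation is
  \<open>v'' + m v(-t) + M v(0) = \<sigma>\<close>. It splits into \<open>e'' + m e + M e(0) = \<sigma>\<^sub>e\<close>, \<open>e'(0) = e'(T) = 0\<close>, for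
  the even part of \<open>v\<close> and \<open>o'' - m o = \<sigma>\<^sub>o\<close>, \<open>o(0) = o(T) = 0\<close>, for the odd part. Both are solved by
  variation of parameters, which identifies \<open>H(t, s) + H(t, -s)\<close> and \<open>H(t, s) - H(t, -s)\<close>. Hence
  positivity of \<open>H\<close> means that the even kernel dominates the odd one in absolute value. At
  \<open>t = 0\<close> and \<open>t = s = T\<close> this gives necessity; sufficiency reduces to the diagonal \<open>t = s\<close> with
  \<open>M\<close> at the critical value, where it is
  \<open>sinh t sinh u sin (t + u) \<le> cos u (cos t - cos (t + u)) sinh (t + u)\<close> for \<open>t + u < \<pi>/2\<close>, a
  consequence of \<open>tanh x \<le> sin x\<close>. The critical value is characterised by
  \<open>1 - (m + M) (1 - cos (\<surd>m t)) / m\<close>, the even solution of the homogeneous equation, vanishing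
  at \<open>T\<close>.\<close>

subsection \<open>Fundamental solutions\<close>

text \<open>\<open>cs k\<close> and \<open>sn k\<close> solve \<open>y'' + k y = 0\<close>; the even part uses \<open>k = m\<close>, the odd part \<open>k = - m\<close>.
  \<open>vs k\<close> is the primitive of \<open>sn k\<close>, which allows \<open>m = 0\<close> to be treated together with \<open>m > 0\<close>.\<close>

definition cs :: "real \<Rightarrow> real \<Rightarrow> real" where
  "cs k t = (if 0 \<le> k then cos (sqrt k * t) else cosh (sqrt (- k) * t))"

definition sn :: "real \<Rightarrow> real \<Rightarrow> real" where
  "sn k t = (if 0 < k then sin (sqrt k * t) / sqrt k
    else if k = 0 then t else sinh (sqrt (- k) * t) / sqrt (- k))"

definition vs :: "real \<Rightarrow> real \<Rightarrow> real" where
  "vs k t = (if k = 0 then t\<^sup>2 / 2 else (1 - cs k t) / k)"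

lemma cs_0 [simp]: "cs k 0 = 1" and sn_0 [simp]: "sn k 0 = 0" and vs_0 [simp]: "vs k 0 = 0"
  and cs_minus [simp]: "cs k (- t) = cs k t" and sn_minus [simp]: "sn k (- t) = - sn k t"
  and vs_minus [simp]: "vs k (- t) = vs k t"
  by (auto simp: cs_def sn_def vs_def)

text \<open>Valid at \<open>k = 0\<close> too; it trades \<open>cs\<close> for \<open>vs\<close>, so
  that the equation for the even part is checked without dividing by \<open>m\<close>.\<close>

lemma cs_eq_vs: "cs k t = 1 - k * vs k t"
  by (auto simp: vs_def cs_def)

lemma cs_add: "cs k (s + t) = cs k s * cs k t - k * sn k s * sn k t"
  by (auto simp: cs_def sn_def cos_add cosh_add distrib_left)

lemma sn_add: "sn k (s + t) = sn k s * cs k t + cs k s * sn k t"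
  by (auto simp: cs_def sn_def sin_add sinh_add distrib_left add_divide_distrib)

lemma cs_diff: "cs k (s - t) = cs k s * cs k t + k * sn k s * sn k t"
  using cs_add[of k s "- t"] by simp

lemma sn_diff: "sn k (s - t) = sn k s * cs k t - cs k s * sn k t"
  using sn_add[of k s "- t"] by simp

lemma cs_sn_pythagoras: "(cs k t)\<^sup>2 + k * (sn k t)\<^sup>2 = 1"
  using cs_diff[of k t t] by (simp add: power2_eq_square)

lemma sqrt_minus_mult_self: "\<not> 0 < k \<Longrightarrow> sqrt (- k) * (sqrt (- k) * x) = - (k * x)"
  by (simp flip: mult.assoc)

lemma has_real_derivative_cs:
  "((\<lambda>t. cs k t) has_real_derivative - k * sn k t) (at t within S)"
  unfolding cs_def sn_def
  by (cases "0 < k"; cases "k = 0")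
    (auto intro!: derivative_eq_intros simp: field_simps sqrt_minus_mult_self)

lemma has_real_derivative_sn:
  "((\<lambda>t. sn k t) has_real_derivative cs k t) (at t within S)"
  unfolding cs_def sn_def
  by (cases "0 < k"; cases "k = 0")
    (auto intro!: derivative_eq_intros simp: field_simps sqrt_minus_mult_self)

lemma has_real_derivative_vs:
  "((\<lambda>t. vs k t) has_real_derivative sn k t) (at t within S)"
  unfolding vs_def
  by (cases "k = 0")
    (auto intro!: derivative_eq_intros has_real_derivative_cs simp: sn_def field_simps)

lemma DERIV_vs_compose [derivative_intros]:
    "(g has_real_derivative d) (at t within S) \<Longrightarrow>
      ((\<lambda>x. vs k (g x)) has_real_derivative sn k (g t) * d) (at t within S)"
  and DERIV_sn_compose [derivative_intros]:
    "(g has_real_derivative d) (at t within S) \<Longrightarrow>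
      ((\<lambda>x. sn k (g x)) has_real_derivative cs k (g t) * d) (at t within S)"
  using DERIV_chain2[OF has_real_derivative_vs] DERIV_chain2[OF has_real_derivative_sn] by blast+

lemma continuous_on_cs [continuous_intros]:
    "continuous_on S g \<Longrightarrow> continuous_on S (\<lambda>x. cs k (g x))"
  and continuous_on_sn [continuous_intros]:
    "continuous_on S g \<Longrightarrow> continuous_on S (\<lambda>x. sn k (g x))"
  and continuous_on_vs [continuous_intros]:
    "continuous_on S g \<Longrightarrow> continuous_on S (\<lambda>x. vs k (g x))"
  using continuous_on_compose2[of UNIV _ S g] has_real_derivative_cs has_real_derivative_sn
    has_real_derivative_vs DERIV_continuous_on[of UNIV] by (metis subset_UNIV)+

lemma sn_neg_pos: "0 \<le> m \<Longrightarrow> 0 < t \<Longrightarrow> 0 < sn (- m) t"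
  by (auto simp: sn_def)

lemma sn_neg_mono: "0 \<le> m \<Longrightarrow> s \<le> t \<Longrightarrow> sn (- m) s \<le> sn (- m) t"
  by (auto simp: sn_def divide_right_mono mult_left_mono)

lemma sn_neg_nonneg: "0 \<le> m \<Longrightarrow> 0 \<le> t \<Longrightarrow> 0 \<le> sn (- m) t"
  by (auto simp: sn_def)

subsection \<open>The diagonal inequality\<close>

lemma tanh_artanh_real:
  fixes x :: real
  assumes "\<bar>x\<bar> < 1"
  shows "tanh (artanh x) = x"
proof -
  have "0 < (1 + x) / (1 - x)" using assms by simp
  then have e: "exp (- 2 * artanh x) = (1 - x) / (1 + x)"
    by (simp add: artanh_def exp_minus)
  show ?thesis
    using assms unfolding tanh_real_altdef e by (simp add: divide_simps)
qed

lemma abs_sin_less_1: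
  fixes x :: real
  assumes "0 < cos x"
  shows "\<bar>sin x\<bar> < 1"
proof -
  have "(sin x)\<^sup>2 < 1"
    using sin_cos_squared_add[of x] zero_less_power[OF assms, of 2] by linarith
  then show ?thesis by (simp only: abs_square_less_1)
qed

text \<open>This is \<open>tanh x <= sin x\<close>, that is \<open>x <= artanh (sin x)\<close>. Both
  sides of the latter vanish at 0, and \<open>artanh (sin y)\<close> has derivative
  \<open>1 / cos y >= 1\<close>.\<close>

lemma sinh_le_sin_mult_cosh:
  fixes x :: real
  assumes "0 \<le> x" "x < pi / 2"
  shows "sinh x \<le> sin x * cosh x"
proof -
  have "artanh (sin 0) - 0 \<le> artanh (sin x) - x"
  proof (rule DERIV_nonneg_imp_nondecreasing[where f = "\<lambda>y. artanh (sin y) - y"])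
    fix y :: real
    assume "0 \<le> y" "y \<le> x"
    then have c: "0 < cos y" using assms by (intro cos_gt_zero_pi) auto
    then have s: "\<bar>sin y\<bar> < 1"
      by (rule abs_sin_less_1)
    have "((\<lambda>y. artanh (sin y) - y) has_real_derivative cos y / (1 - (sin y)\<^sup>2) - 1) (at y)"
      using s by (intro DERIV_diff DERIV_ident DERIV_chain2[OF artanh_real_has_field_derivative, THEN DERIV_cong]) (auto intro!: derivative_eq_intros)
    moreover have "cos y / (1 - (sin y)\<^sup>2) - 1 = 1 / cos y - 1"
      using c by (simp flip: cos_squared_eq add: power2_eq_square[of "cos y"])
    moreover have "0 \<le> 1 / cos y - 1" using c by simp
    ultimately show "\<exists>d. ((\<lambda>y. artanh (sin y) - y) has_real_derivative d) (at y) \<and> 0 \<le> d"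
      by metis
  qed (use assms in auto)
  then have "x \<le> artanh (sin x)" by simp
  moreover have "\<bar>sin x\<bar> < 1"
    using assms by (intro abs_sin_less_1 cos_gt_zero_pi) auto
  ultimately have "tanh x \<le> sin x"
    by (metis tanh_real_le_iff tanh_artanh_real)
  then show ?thesis
    by (simp add: tanh_def field_simps)
qed

text \<open>\<open>mono\<close> replaces the hyperbolic product by a trigonometric one and
  \<open>trig\<close> bounds the latter; both carry the positive factor
  \<open>sin t + sin u\<close>, which cancels at the end.\<close>

lemma sinh_sinh_sin_le:
  fixes t u :: real
  assumes "0 < t" "0 < u" "t + u < pi / 2"
  shows "sinh t * sinh u * sin (t + u) \<le> cos u * (cos t - cos (t + u)) * sinh (t + u)"
proof -
  define a b where "a = t / 2" and "b = u / 2"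
  have tu: "t = a + a" "u = b + b" by (auto simp: a_def b_def)
  have st: "0 < sin t" "0 < sin u" and cu: "0 \<le> cos u"
    using assms by (auto intro!: sin_gt_zero cos_ge_zero)
  have half: "0 < cos b" "0 \<le> sin b" "0 < sin (a + b)"
    using assms by (auto simp: a_def b_def intro!: cos_gt_zero_pi sin_ge_zero sin_gt_zero)
  have sinh_pos: "0 < sinh t" "0 < sinh u" using assms by auto
  \<comment> \<open>Divided by \<open>sinh t * sinh u * sin t * sin u\<close>, this reads
    \<open>1 / sin t + 1 / sin u <= coth t + coth u\<close>.\<close>
  have mono: "sinh t * sinh u * (sin t + sin u) \<le> sin t * sin u * sinh (t + u)"
  proof -
    have "sinh t * sin t * sinh u \<le> sinh t * sin t * (sin u * cosh u)"
      using sinh_le_sin_mult_cosh[of u] assms st sinh_pos by (intro mult_left_mono) auto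
    moreover have "sinh u * sin u * sinh t \<le> sinh u * sin u * (sin t * cosh t)"
      using sinh_le_sin_mult_cosh[of t] assms st sinh_pos by (intro mult_left_mono) auto
    ultimately show ?thesis by (simp add: sinh_add algebra_simps)
  qed
  \<comment> \<open>In half angles both sides share the factor
    \<open>4 * sin b * sin (a + b)\<close>; what remains is the product of facts \<open>2\<close>
    and \<open>1\<close>.\<close>
  have trig: "sin t * sin u * sin (t + u) \<le> cos u * (cos t - cos (t + u)) * (sin t + sin u)"
  proof -
    have 1: "cos (a + b) \<le> cos (a - b)"
    proof -
      have "0 \<le> sin a" "0 \<le> sin b" using assms by (auto simp: a_def b_def intro!: sin_ge_zero)
      then show ?thesis by (simp add: cos_add cos_diff)
    qed
    \<comment> \<open>The gap is \<open>sin b * cos (t + u)\<close>, nonnegative because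
      \<open>t + u < pi / 2\<close>.\<close>
    have 2: "sin t * cos b \<le> cos u * sin (t + b)"
    proof -
      have "cos u * sin (t + b) - sin t * cos b
          = cos u * cos t * sin b - sin t * cos b * (1 - cos u)"
        by (simp add: sin_add algebra_simps)
      also have "1 - cos u = 2 * sin b * sin b"
        using cos_double_sin[of b] by (simp add: tu power2_eq_square)
      also have "cos u * cos t * sin b - sin t * cos b * (2 * sin b * sin b)
          = sin b * (cos u * cos t - sin t * (2 * sin b * cos b))"
        by (simp add: algebra_simps)
      also have "2 * sin b * cos b = sin u" using sin_double[of b] by (simp add: tu)
      also have "cos u * cos t - sin t * sin u = cos (t + u)" by (simp add: cos_add)
      finally have "cos u * sin (t + b) - sin t * cos b = sin b * cos (t + u)" .
      moreover have "0 \<le> sin b * cos (t + u)"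
        using half assms by (intro mult_nonneg_nonneg cos_ge_zero) auto
      ultimately show ?thesis by simp
    qed
    have e1: "cos t - cos (t + u) = 2 * sin (t + b) * sin b"
      using cos_diff_cos[of t "t + u"] by (simp add: b_def add_divide_distrib)
    have e2: "sin t + sin u = 2 * sin (a + b) * cos (a - b)"
      using sin_plus_sin[of t u] by (simp add: a_def b_def add_divide_distrib diff_divide_distrib)
    have e3: "sin (t + u) = 2 * sin (a + b) * cos (a + b)"
      using sin_double[of "a + b"] by (simp add: tu algebra_simps)
    have e4: "sin u = 2 * sin b * cos b" using sin_double[of b] by (simp add: tu)
    have ab: "0 \<le> cos (a + b)" and nn: "0 \<le> sin (t + b)"
      using assms by (auto simp: a_def b_def intro!: sin_ge_zero cos_ge_zero)
    have "sin t * cos b * cos (a + b) \<le> cos u * sin (t + b) * cos (a - b)"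
      using 1 2 ab st half cu nn by (intro mult_mono[OF 2 1] mult_nonneg_nonneg) auto
    then have "(4 * sin b * sin (a + b)) * (sin t * cos b * cos (a + b))
        \<le> (4 * sin b * sin (a + b)) * (cos u * sin (t + b) * cos (a - b))"
      using half by (intro mult_left_mono) auto
    then have "sin t * (2 * sin b * cos b) * (2 * sin (a + b) * cos (a + b))
        \<le> cos u * (2 * sin (t + b) * sin b) * (2 * sin (a + b) * cos (a - b))"
      by (simp add: mult_ac)
    then show ?thesis by (simp only: e1 e2 e3 flip: e4)
  qed
  have "(sinh t * sinh u * sin (t + u)) * (sin t + sin u)
      \<le> (sin t * sin u * sinh (t + u)) * sin (t + u)"
    using mult_right_mono[OF mono, of "sin (t + u)"] assms
    by (simp add: mult_ac sin_ge_zero)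
  also have "\<dots> = (sin t * sin u * sin (t + u)) * sinh (t + u)" by simp
  also have "\<dots> \<le> (cos u * (cos t - cos (t + u)) * (sin t + sin u)) * sinh (t + u)"
    using trig assms by (intro mult_right_mono) auto
  also have "\<dots> = (cos u * (cos t - cos (t + u)) * sinh (t + u)) * (sin t + sin u)" by simp
  finally show ?thesis
    using st by (simp only: mult_le_cancel_right_pos add_pos_pos)
qed

text \<open>For \<open>m > 0\<close>, rescaling by \<open>w = sqrt m\<close> and dividing by
  \<open>w * w * w\<close> leads to \<open>sinh_sinh_sin_le\<close>. With \<open>t + u = T\<close>
  it compares the two kernels on the diagonal at the critical value of \<open>M\<close>.\<close>

lemma sn_diagonal_le:
  assumes "0 \<le> m" "0 \<le> t" "0 \<le> u" "sqrt m * (t + u) < pi / 2"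
  shows "sn (- m) t * sn (- m) u * sn m (t + u)
    \<le> cs m u * (vs m (t + u) - vs m t) * sn (- m) (t + u)"
proof (cases "t = 0 \<or> u = 0")
  case True
  then show ?thesis
  proof
    assume t: "t = 0"
    have "0 \<le> cs m u"
    proof -
      have lo: "0 \<le> sqrt m * u" and hi: "sqrt m * u < pi / 2" using assms t by auto
      have "0 \<le> cos (sqrt m * u)"
        by (rule cos_ge_zero) (use lo hi pi_gt_zero in linarith)+
      then show ?thesis using assms by (simp add: cs_def)
    qed
    moreover have "0 \<le> vs m u" using assms by (auto simp: vs_def cs_def)
    ultimately show ?thesis using t assms sn_neg_nonneg[of m u] by simp
  qed simp
next
  case False
  with assms have pos: "0 < t" "0 < u" by auto
  show ?thesis
  proof (cases "m = 0")
    case True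
    \<comment> \<open>Twice the gap between the two sides at \<open>m = 0\<close>.\<close>
    have "0 \<le> u * (t + u) * u" using pos by simp
    then show ?thesis using True
      by (simp add: sn_def cs_def vs_def power2_eq_square field_simps)
  next
    case False
    define w where "w = sqrt m"
    have w: "0 < w" "m = w * w" using assms False by (auto simp: w_def)
    have eqs: "sn (- m) x = sinh (w * x) / w" "sn m x = sin (w * x) / w" "cs m x = cos (w * x)"
      "vs m x - vs m y = (cos (w * y) - cos (w * x)) / (w * w)" for x y
      using w(1) assms(1) False unfolding w(2)[symmetric]
      by (auto simp: sn_def cs_def vs_def w_def[symmetric] diff_divide_distrib)
    have "sinh (w * t) * sinh (w * u) * sin (w * t + w * u)
      \<le> cos (w * u) * (cos (w * t) - cos (w * t + w * u)) * sinh (w * t + w * u)"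
      using assms(4) pos w(1) by (intro sinh_sinh_sin_le) (auto simp: w_def[symmetric] distrib_left)
    then have "sinh (w * t) * sinh (w * u) * sin (w * t + w * u) / (w * w * w)
      \<le> cos (w * u) * (cos (w * t) - cos (w * t + w * u)) * sinh (w * t + w * u) / (w * w * w)"
      using w by (intro divide_right_mono) auto
    then show ?thesis unfolding eqs by (simp add: distrib_left)
  qed
qed

subsection \<open>Variation of parameters\<close>

text \<open>The signed integral from 0 to \<open>t\<close>: the term whose interval has the wrong
  orientation runs over the empty set or a point and is 0.\<close>

definition primitive :: "(real \<Rightarrow> real) \<Rightarrow> real \<Rightarrow> real" where
  "primitive f t = integral {0..t} f - integral {t..0} f"

lemma primitive_nonneg: "0 \<le> t \<Longrightarrow> primitive f t = integral {0..t} f"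
  by (cases "t = 0") (auto simp: primitive_def)

lemma primitive_0 [simp]: "primitive f 0 = 0"
  by (simp add: primitive_def)

lemma primitive_minus: "primitive f (- t) = - primitive (\<lambda>x. f (- x)) t"
  using Henstock_Kurzweil_Integration.integral_reflect_real[of 0 t "\<lambda>x. f (- x)"] Henstock_Kurzweil_Integration.integral_reflect_real[of t 0 "\<lambda>x. f (- x)"]
  by (simp add: primitive_def)

lemma primitive_cmult: "primitive (\<lambda>x. c * f x) t = c * primitive f t"
  by (simp add: primitive_def right_diff_distrib)

lemma has_real_derivative_primitive:
  assumes "0 < T" "continuous_on {-T..T} f" "t \<in> {-T..T}"
  shows "(primitive f has_real_derivative f t) (at t within {-T..T})"
proof -
  \<comment> \<open>Moving the base point to \<open>-T\<close> makes the fundamental theorem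
    applicable on both sides of 0 at once.\<close>
  have "primitive f x = integral {-T..x} f - integral {-T..0} f" if "x \<in> {-T..T}" for x
  proof -
    have int: "f integrable_on {-T..y}" if "y \<le> T" for y
      by (rule integrable_continuous_interval[OF continuous_on_subset[OF assms(2)]]) (use that in auto)
    show ?thesis
    proof (cases "0 \<le> x")
      case True
      then show ?thesis
        using Henstock_Kurzweil_Integration.integral_combine[OF _ True int[of x]] that assms by (simp add: primitive_nonneg)
    next
      case False
      then show ?thesis
        using Henstock_Kurzweil_Integration.integral_combine[OF _ _ int[of 0], of x] that assms by (simp add: primitive_def)
    qed
  qed
  moreover have "((\<lambda>x. integral {-T..x} f - integral {-T..0} f) has_real_derivative f t)
      (at t within {-T..T})"
    using integral_has_real_derivative[of "-T" T f t] assms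
    by (auto intro!: derivative_eq_intros)
  ultimately show ?thesis
    using has_field_derivative_transform_within[of _ "f t" t "{-T..T}" 1 "primitive f"] assms
    by simp
qed

text \<open>The convolution of \<open>sn k\<close> with \<open>f\<close> from 0 to \<open>t\<close>,
  expanded by the addition theorem so that \<open>t\<close> does not occur under the integral and
  the product rule suffices for differentiation.\<close>

definition vpar :: "real \<Rightarrow> (real \<Rightarrow> real) \<Rightarrow> real \<Rightarrow> real" where
  "vpar k f t = sn k t * primitive (\<lambda>s. cs k s * f s) t - cs k t * primitive (\<lambda>s. sn k s * f s) t"

definition vpar' :: "real \<Rightarrow> (real \<Rightarrow> real) \<Rightarrow> real \<Rightarrow> real" where
  "vpar' k f t = cs k t * primitive (\<lambda>s. cs k s * f s) t + k * sn k t * primitive (\<lambda>s. sn k s * f s) t"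

lemma vpar_0 [simp]: "vpar k f 0 = 0"
  by (simp add: vpar_def)

lemma has_real_derivative_vpar:
  assumes "0 < T" "continuous_on {-T..T} f" "t \<in> {-T..T}"
  shows "(vpar k f has_real_derivative vpar' k f t) (at t within {-T..T})"
    and "(vpar' k f has_real_derivative f t - k * vpar k f t) (at t within {-T..T})"
proof -
  have c: "(primitive (\<lambda>s. cs k s * f s) has_real_derivative cs k t * f t) (at t within {-T..T})"
    and s: "(primitive (\<lambda>s. sn k s * f s) has_real_derivative sn k t * f t) (at t within {-T..T})"
    using assms by (auto intro!: has_real_derivative_primitive continuous_intros)
  note D = has_real_derivative_cs[of k t "{-T..T}"] has_real_derivative_sn[of k t "{-T..T}"]
  show "(vpar k f has_real_derivative vpar' k f t) (at t within {-T..T})"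
    unfolding vpar_def [abs_def] vpar'_def
    by (rule DERIV_cong[OF DERIV_diff[OF DERIV_mult'[OF D(2) c] DERIV_mult'[OF D(1) s]]])
      (simp add: algebra_simps)
  have eq: "cs k t * (cs k t * f t) + k * sn k t * (sn k t * f t) = f t"
    using arg_cong[OF cs_sn_pythagoras[of k t], of "\<lambda>x. x * f t"]
    by (simp add: algebra_simps power2_eq_square)
  show "(vpar' k f has_real_derivative f t - k * vpar k f t) (at t within {-T..T})"
    unfolding vpar_def vpar'_def [abs_def]
    by (rule DERIV_cong[OF DERIV_add[OF DERIV_mult'[OF D(1) c]
            DERIV_mult'[OF DERIV_cmult[OF D(2), of k] s]]])
      (use eq in \<open>simp add: algebra_simps\<close>)
qed

text \<open>Used with \<open>c = 1\<close> for even and \<open>c = -1\<close> for odd data. As the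
  parity of \<open>f\<close> passes to the particular solution, the periodic conditions reduce to
  one condition at \<open>T\<close>.\<close>

lemma vpar_minus:
  assumes "\<And>x. f (- x) = c * f x"
  shows "vpar k f (- t) = c * vpar k f t" and "vpar' k f (- t) = - c * vpar' k f t"
proof -
  have "(\<lambda>s. cs k (- s) * f (- s)) = (\<lambda>s. c * (cs k s * f s))"
    and "(\<lambda>s. sn k (- s) * f (- s)) = (\<lambda>s. - c * (sn k s * f s))"
    by (simp_all add: assms fun_eq_iff)
  then have "primitive (\<lambda>s. cs k s * f s) (- t) = - c * primitive (\<lambda>s. cs k s * f s) t"
    and "primitive (\<lambda>s. sn k s * f s) (- t) = c * primitive (\<lambda>s. sn k s * f s) t"
    by (simp_all only: primitive_minus primitive_cmult minus_mult_left minus_minus)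
  then show "vpar k f (- t) = c * vpar k f t" "vpar' k f (- t) = - c * vpar' k f t"
    by (simp_all add: vpar_def vpar'_def algebra_simps)
qed

text \<open>Returns to the convolution form, from which the kernels are read off.\<close>

lemma vpar_integral:
  assumes "continuous_on {0..t} f" "0 \<le> t"
  shows "vpar k f t = integral {0..t} (\<lambda>s. sn k (t - s) * f s)"
    and "vpar' k f t = integral {0..t} (\<lambda>s. cs k (t - s) * f s)"
proof -
  have i: "(\<lambda>s. c * (cs k s * f s)) integrable_on {0..t}"
    "(\<lambda>s. c * (sn k s * f s)) integrable_on {0..t}" for c
    using assms by (auto intro!: integrable_continuous_interval continuous_intros)
  have "integral {0..t} (\<lambda>s. sn k (t - s) * f s)
      = integral {0..t} (\<lambda>s. sn k t * (cs k s * f s) - cs k t * (sn k s * f s))"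
    by (simp add: sn_diff algebra_simps)
  also have "\<dots> = vpar k f t"
    by (simp add: vpar_def primitive_nonneg assms integral_diff[OF i])
  finally show "vpar k f t = integral {0..t} (\<lambda>s. sn k (t - s) * f s)" ..
  have "integral {0..t} (\<lambda>s. cs k (t - s) * f s)
      = integral {0..t} (\<lambda>s. cs k t * (cs k s * f s) + (k * sn k t) * (sn k s * f s))"
    by (simp add: cs_diff algebra_simps)
  also have "\<dots> = vpar' k f t"
    by (subst integral_add[OF i]) (simp add: vpar'_def primitive_nonneg assms)
  finally show "vpar' k f t = integral {0..t} (\<lambda>s. cs k (t - s) * f s)" ..
qed

text \<open>Since \<open>sn k 0 = 0\<close>, the cut-off by \<open>max\<close> extends the kernel
  continuously by 0, and the range of integration no longer depends on \<open>t\<close>.\<close>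

lemma integral_max_kernel:
  fixes f :: "real \<Rightarrow> real"
  assumes "continuous_on {0..T} f" "0 \<le> t" "t \<le> T"
  shows "integral {0..T} (\<lambda>s. sn k (max (t - s) 0) * f s) = integral {0..t} (\<lambda>s. sn k (t - s) * f s)"
proof -
  have "(\<lambda>s. sn k (max (t - s) 0) * f s) integrable_on {0..T}"
    using assms by (auto intro!: integrable_continuous_interval continuous_intros)
  from Henstock_Kurzweil_Integration.integral_combine[OF assms(2,3) this]
  have "integral {0..T} (\<lambda>s. sn k (max (t - s) 0) * f s)
      = integral {0..t} (\<lambda>s. sn k (max (t - s) 0) * f s)
        + integral {t..T} (\<lambda>s. sn k (max (t - s) 0) * f s)" by simp
  also have "integral {0..t} (\<lambda>s. sn k (max (t - s) 0) * f s)
      = integral {0..t} (\<lambda>s. sn k (t - s) * f s)"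
    by (rule integral_cong) (auto simp: max_def)
  also have "integral {t..T} (\<lambda>s. sn k (max (t - s) 0) * f s) = integral {t..T} (\<lambda>s. 0)"
    by (rule integral_cong) (auto simp: max_def)
  finally show ?thesis by simp
qed

subsection \<open>Periodic solutions\<close>

text \<open>The only possible exceptions are -1 and 1, which form a null set.\<close>

lemma AE_trunc_eq_0:
  assumes "T \<le> 1"
  shows "AE t in lebesgue_on {-T..T}. trunc t = 0"
proof -
  have "AE t in lebesgue. t \<notin> {-1, 1 :: real}"
    by (rule AE_not_in) (simp add: negligible_iff_null_sets[symmetric])
  then have "AE t in lebesgue. t \<in> {-T..T} \<longrightarrow> trunc t = 0"
  proof eventually_elim
    case (elim t)
    show ?case
    proof
      assume "t \<in> {-T..T}"
      with elim assms have "-1 < t" "t < 1" by auto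
      then show "trunc t = 0" by (auto simp: trunc_def floor_eq_iff ceiling_eq_iff)
    qed
  qed
  then show ?thesis by (simp add: AE_restrict_space_iff)
qed

text \<open>The derivative is bounded by some \<open>B\<close> on the compact interval, so
  \<open>f\<close> is Lipschitz and \<open>e / B\<close> serves as delta.\<close>

lemma abs_continuous_on_C1:
  assumes "\<And>t. t \<in> {a..b} \<Longrightarrow> (f has_real_derivative f' t) (at t within {a..b})"
    and "continuous_on {a..b} f'"
  shows "abs_continuous_on a b f"
proof -
  obtain B where B: "0 < B" "\<And>t. t \<in> {a..b} \<Longrightarrow> \<bar>f' t\<bar> \<le> B"
    using compact_imp_bounded[OF compact_continuous_image[OF assms(2) compact_Icc]]
    unfolding bounded_pos by auto
  have lip: "\<bar>f y - f x\<bar> \<le> B * (y - x)" if "a \<le> x" "x \<le> y" "y \<le> b" for x y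
    using field_differentiable_bound[of "{a..b}" f f' B y x] assms(1) B that by simp
  show ?thesis
    unfolding abs_continuous_on_def
  proof (intro allI impI)
    fix e :: real
    assume "0 < e"
    show "\<exists>d>0. \<forall>(n :: nat) x y. (\<forall>i<n. a \<le> x i \<and> x i \<le> y i \<and> y i \<le> b) \<and>
        (\<forall>i<n. \<forall>j<n. i \<noteq> j \<longrightarrow> y i \<le> x j \<or> y j \<le> x i) \<and> (\<Sum>i<n. y i - x i) < d \<longrightarrow>
        (\<Sum>i<n. \<bar>f (y i) - f (x i)\<bar>) < e"
    proof (intro exI[of _ "e / B"] conjI allI impI; (elim conjE)?)
      fix n :: nat and x y :: "nat \<Rightarrow> real"
      assume xy: "\<forall>i<n. a \<le> x i \<and> x i \<le> y i \<and> y i \<le> b" and d: "(\<Sum>i<n. y i - x i) < e / B"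
      have "(\<Sum>i<n. \<bar>f (y i) - f (x i)\<bar>) \<le> (\<Sum>i<n. B * (y i - x i))"
        using xy by (intro sum_mono lip) auto
      also have "\<dots> = B * (\<Sum>i<n. y i - x i)" by (simp add: sum_distrib_left)
      also have "\<dots> < e" using d B(1) by (simp add: field_simps)
      finally show "(\<Sum>i<n. \<bar>f (y i) - f (x i)\<bar>) < e" .
    qed (use \<open>0 < e\<close> B(1) in simp)
  qed
qed

lemma abs_continuous_on_diff:
  assumes "abs_continuous_on a b f" "abs_continuous_on a b g"
  shows "abs_continuous_on a b (\<lambda>x. f x - g x)"
  unfolding abs_continuous_on_def
proof (intro allI impI)
  fix e :: real
  assume "0 < e"
  let ?I = "\<lambda>(n :: nat) x y. (\<forall>i<n. a \<le> x i \<and> x i \<le> y i \<and> y i \<le> b) \<and>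
    (\<forall>i<n. \<forall>j<n. i \<noteq> j \<longrightarrow> y i \<le> x j \<or> y j \<le> x i)"
  have *: "\<exists>d>0. \<forall>n x y. ?I n x y \<longrightarrow> (\<Sum>i<n. y i - x i) < d \<longrightarrow> (\<Sum>i<n. \<bar>h (y i) - h (x i)\<bar>) < e / 2"
    if "abs_continuous_on a b h" for h
    using that[unfolded abs_continuous_on_def, rule_format, of "e / 2"] \<open>0 < e\<close>
    by (simp only: conj_assoc imp_conjL half_gt_zero)
  obtain d1 where d1: "0 < d1"
    and f: "\<And>n x y. ?I n x y \<Longrightarrow> (\<Sum>i<n. y i - x i) < d1 \<Longrightarrow> (\<Sum>i<n. \<bar>f (y i) - f (x i)\<bar>) < e / 2"
    using *[OF assms(1)] by (elim exE conjE) (rule that, assumption, blast)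
  obtain d2 where d2: "0 < d2"
    and g: "\<And>n x y. ?I n x y \<Longrightarrow> (\<Sum>i<n. y i - x i) < d2 \<Longrightarrow> (\<Sum>i<n. \<bar>g (y i) - g (x i)\<bar>) < e / 2"
    using *[OF assms(2)] by (elim exE conjE) (rule that, assumption, blast)
  show "\<exists>d>0. \<forall>(n :: nat) x y. (\<forall>i<n. a \<le> x i \<and> x i \<le> y i \<and> y i \<le> b) \<and>
      (\<forall>i<n. \<forall>j<n. i \<noteq> j \<longrightarrow> y i \<le> x j \<or> y j \<le> x i) \<and> (\<Sum>i<n. y i - x i) < d \<longrightarrow>
      (\<Sum>i<n. \<bar>f (y i) - g (y i) - (f (x i) - g (x i))\<bar>) < e"
  proof (intro exI[of _ "min d1 d2"] conjI allI impI; (elim conjE)?)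
    fix n :: nat and x y :: "nat \<Rightarrow> real"
    assume xy: "\<forall>i<n. a \<le> x i \<and> x i \<le> y i \<and> y i \<le> b"
        "\<forall>i<n. \<forall>j<n. i \<noteq> j \<longrightarrow> y i \<le> x j \<or> y j \<le> x i"
      and d: "(\<Sum>i<n. y i - x i) < min d1 d2"
    have "(\<Sum>i<n. \<bar>f (y i) - g (y i) - (f (x i) - g (x i))\<bar>)
        \<le> (\<Sum>i<n. \<bar>f (y i) - f (x i)\<bar> + \<bar>g (y i) - g (x i)\<bar>)"
      by (intro sum_mono) linarith
    also have "\<dots> < e"
      using f[OF conjI[OF xy]] g[OF conjI[OF xy]] d by (simp add: sum.distrib)
    finally show "(\<Sum>i<n. \<bar>f (y i) - g (y i) - (f (x i) - g (x i))\<bar>) < e" .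
  qed (use d1 d2 in simp)
qed

lemma admissible_C2:
  assumes "0 < T"
    and v: "\<And>t. t \<in> {-T..T} \<Longrightarrow> (v has_real_derivative v1 t) (at t within {-T..T})"
    and v1: "\<And>t. t \<in> {-T..T} \<Longrightarrow> (v1 has_real_derivative v2 t) (at t within {-T..T})"
    and v2: "continuous_on {-T..T} v2"
  shows "admissible T v v1 v2"
proof -
  have "(v2 \<longlongrightarrow> v2 T) (at_left T)"
    using v2 assms(1) by (simp add: continuous_on_Icc_at_leftD)
  moreover have "continuous_on {-T..<T} v2"
    using v2 by (rule continuous_on_subset) auto
  moreover have "continuous_on {-T..T} v1"
    using v1 by (rule DERIV_continuous_on)
  ultimately show ?thesis
    unfolding admissible_def using v v1 v2 abs_continuous_on_C1[OF v1 v2] by auto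
qed

lemma admissible_diff:
  assumes "admissible T v v1 v2" "admissible T w w1 w2"
  shows "admissible T (\<lambda>t. v t - w t) (\<lambda>t. v1 t - w1 t) (\<lambda>t. v2 t - w2 t)"
proof (cases "T < 1")
  case True
  then show ?thesis
    using assms unfolding admissible_def
    by (simp add: DERIV_diff continuous_on_diff abs_continuous_on_diff)
next
  case False
  then obtain L K where "(v2 \<longlongrightarrow> L) (at_left T)" "(w2 \<longlongrightarrow> K) (at_left T)"
    using assms unfolding admissible_def by auto
  then have "\<exists>L. ((\<lambda>t. v2 t - w2 t) \<longlongrightarrow> L) (at_left T)"
    using tendsto_diff by blast
  with False show ?thesis
    using assms unfolding admissible_def
    by (simp add: DERIV_diff continuous_on_diff abs_continuous_on_diff)
qed

lemma solves_equationI: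
  assumes "T \<le> 1" "\<And>t. t \<in> {-T..T} \<Longrightarrow> v2 t + m * v (- t) + M * v 0 = \<sigma> t"
  shows "solves_equation T m M \<sigma> v v2"
  unfolding solves_equation_def
  using AE_trunc_eq_0[OF assms(1)] AE_space
  by eventually_elim (use assms(2) in simp)

text \<open>The difference of two solutions solves the homogeneous problem. This opens the integral
  representation by the Green's function to every explicitly known solution.\<close>

lemma unique_periodic_solutionI:
  assumes "unique_periodic_solution T m M (\<lambda>_. 0) (\<lambda>_. 0)" and v: "periodic_solution T m M \<sigma> v"
  shows "unique_periodic_solution T m M \<sigma> v"
  unfolding unique_periodic_solution_def
proof (intro conjI allI impI v)
  fix w
  assume w: "periodic_solution T m M \<sigma> w"
  from v w obtain v1 v2 w1 w2 where
    adm: "admissible T w w1 w2" "admissible T v v1 v2"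
    and sol: "solves_equation T m M \<sigma> w w2" "solves_equation T m M \<sigma> v v2"
    and bc: "v T = v (- T)" "v1 (- T) = v1 T" "w T = w (- T)" "w1 (- T) = w1 T"
    unfolding periodic_solution_def by blast
  have "solves_equation T m M (\<lambda>_. 0) (\<lambda>t. w t - v t) (\<lambda>t. w2 t - v2 t)"
    using sol unfolding solves_equation_def by eventually_elim (simp add: algebra_simps)
  then have "periodic_solution T m M (\<lambda>_. 0) (\<lambda>t. w t - v t)"
    unfolding periodic_solution_def using admissible_diff[OF adm] bc
    by (intro exI[of _ "\<lambda>t. w1 t - v1 t"] exI[of _ "\<lambda>t. w2 t - v2 t"]) simp
  then show "\<forall>t\<in>{-T..T}. w t = v t"
    using assms(1) unfolding unique_periodic_solution_def by fastforce
qed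

text \<open>The test by which explicit solutions are verified: for continuous data the second
  derivative is given everywhere by the equation with \<open>trunc t\<close> replaced by 0, a change
  on a null set only.\<close>

lemma periodic_solution_C2:
  assumes "0 < T" "T \<le> 1"
    and "\<And>t. t \<in> {-T..T} \<Longrightarrow> (v has_real_derivative v1 t) (at t within {-T..T})"
    and "\<And>t. t \<in> {-T..T} \<Longrightarrow> (v1 has_real_derivative \<sigma> t - m * v (- t) - M * v 0) (at t within {-T..T})"
    and "continuous_on {-T..T} \<sigma>" "v T = v (- T)" "v1 (- T) = v1 T"
  shows "periodic_solution T m M \<sigma> v"
proof -
  have cv: "continuous_on {-T..T} v"
    using assms(3) by (rule DERIV_continuous_on)
  have "continuous_on {-T..T} (\<lambda>t. v (- t))"
    by (rule continuous_on_compose2[OF cv]) (auto intro!: continuous_intros)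
  then have "admissible T v v1 (\<lambda>t. \<sigma> t - m * v (- t) - M * v 0)"
    using assms by (intro admissible_C2 continuous_intros) auto
  moreover have "solves_equation T m M \<sigma> v (\<lambda>t. \<sigma> t - m * v (- t) - M * v 0)"
    using assms by (intro solves_equationI) auto
  ultimately show ?thesis
    unfolding periodic_solution_def using assms by blast
qed

lemma greens_function_represents:
  assumes "greens_function T m M H" "continuous_on {-T..T} \<sigma>" "periodic_solution T m M \<sigma> v"
    and "t \<in> {-T..T}"
  shows "v t = integral {-T..T} (\<lambda>s. H t s * \<sigma> s)"
proof -
  from assms(1) have "unique_periodic_solution T m M (\<lambda>_. 0) (\<lambda>_. 0)"
    by (simp add: greens_function_def)
  from unique_periodic_solutionI[OF this assms(3)] have "unique_periodic_solution T m M \<sigma> v" .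
  with assms(1) absolutely_integrable_continuous_real[OF assms(2)] assms(4) show ?thesis
    unfolding greens_function_def by simp
qed

text \<open>With \<open>k = m + M\<close> this is the even solution of the homogeneous equation with
  value \<open>c\<close> at 0.\<close>

lemma has_real_derivative_even_homogeneous:
  "((\<lambda>t. c * (1 - k * vs m t)) has_real_derivative - c * k * sn m t) (at t within S)"
  "((\<lambda>t. - c * k * sn m t) has_real_derivative - c * k * cs m t) (at t within S)"
  by (rule derivative_eq_intros refl | simp)+

subsection \<open>The Green's function\<close>

text \<open>The test function is the difference itself, so the integral of the continuous function
  \<open>(f - g)^2\<close> vanishes.\<close>

lemma continuous_eq_if_integrals_eq:
  fixes f g :: "real \<Rightarrow> real"
  assumes "a < b" "continuous_on {a..b} f" "continuous_on {a..b} g"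
    and "integral {a..b} (\<lambda>s. f s * (f s - g s)) = integral {a..b} (\<lambda>s. g s * (f s - g s))"
    and "s \<in> {a..b}"
  shows "f s = g s"
proof -
  have "integral {a..b} (\<lambda>s. (f s - g s) * (f s - g s))
      = integral {a..b} (\<lambda>s. f s * (f s - g s) - g s * (f s - g s))"
    by (simp add: left_diff_distrib)
  also have "\<dots> = 0"
    using assms by (subst integral_diff) (auto intro!: integrable_continuous_interval continuous_intros)
  finally have "\<forall>x\<in>{a..b}. (f x - g x) * (f x - g x) = 0"
    using assms
    by (subst (asm) Equivalence_Lebesgue_Henstock_Integration.integral_eq_0_iff)
      (auto intro!: continuous_intros)
  then show ?thesis using assms(5) by simp
qed

lemma integral_symmetric_interval:
  fixes f :: "real \<Rightarrow> real"
  assumes "0 < T" "continuous_on {-T..T} f"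
  shows "integral {-T..T} f = integral {0..T} (\<lambda>s. f s + f (- s))"
proof -
  have c: "continuous_on {0..T} f" "continuous_on {0..T} (\<lambda>s. f (- s))"
    by (rule continuous_on_subset[OF assms(2)], use assms in simp)
      (rule continuous_on_compose2[OF assms(2)], auto intro!: continuous_intros)
  have "integral {-T..T} f = integral {-T..0} f + integral {0..T} f"
    using Henstock_Kurzweil_Integration.integral_combine[of "-T" 0 T f] assms
    by (simp add: integrable_continuous_interval)
  also have "integral {-T..0} f = integral {0..T} (\<lambda>s. f (- s))"
    using Henstock_Kurzweil_Integration.integral_reflect_real[of T 0 "\<lambda>s. f (- s)"] by simp
  finally show ?thesis
    using c by (simp add: Henstock_Kurzweil_Integration.integral_add integrable_continuous_interval)
qed

lemma continuous_on_greens_function: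
  assumes "greens_function T m M H" "t \<in> {-T..T}"
  shows "continuous_on {-T..T} (H t)"
proof -
  have "continuous_on ({-T..T} \<times> {-T..T}) (\<lambda>(t, s). H t s)"
    using assms(1) by (simp add: greens_function_def)
  moreover have "continuous_on {-T..T} (\<lambda>s. (t, s))"
    by (intro continuous_intros)
  ultimately have "continuous_on {-T..T} (\<lambda>s. (\<lambda>(t, s). H t s) (t, s))"
    by (rule continuous_on_compose2) (use assms(2) in auto)
  then show ?thesis by simp
qed

text \<open>Kernel on \<open>{0..T}\<close> of \<open>e'' + m e + M e(0) = p\<close>,
  \<open>e'(0) = e'(T) = 0\<close>. The first summand is a multiple of the even homogeneous
  solution, adjusted to give \<open>e'(T) = 0\<close>; the second is variation of
  parameters.\<close>

definition even_kernel :: "real \<Rightarrow> real \<Rightarrow> real \<Rightarrow> real \<Rightarrow> real \<Rightarrow> real" where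
  "even_kernel T m M t s
    = cs m (T - s) * ((1 / (m + M) - vs m t) / sn m T) + sn m (max (t - s) 0)"

text \<open>Kernel on \<open>{0..T}\<close> of \<open>o'' - m o = q\<close>,
  \<open>o(0) = o(T) = 0\<close>, where the second term enforces \<open>o(T) = 0\<close>.
  \<open>M\<close> is absent because \<open>o(0) = 0\<close>.\<close>

definition odd_kernel :: "real \<Rightarrow> real \<Rightarrow> real \<Rightarrow> real \<Rightarrow> real" where
  "odd_kernel T m t s
    = sn (- m) (max (t - s) 0) - sn (- m) t / sn (- m) T * sn (- m) (T - s)"

text \<open>If \<open>sn m T\<close> vanished, the even homogeneous solution with value 1 at 0 would
  have derivative 0 at both end points and be a nontrivial periodic solution.\<close>

lemma sn_nonzero:
  assumes "0 < T" "T \<le> 1" "0 < m + M" "greens_function T m M H"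
  shows "sn m T \<noteq> 0"
proof
  assume S: "sn m T = 0"
  let ?v = "\<lambda>t. 1 * (1 - (m + M) * vs m t)"
  have "periodic_solution T m M (\<lambda>_. 0) ?v"
  proof (rule periodic_solution_C2[OF assms(1,2)])
    show "(?v has_real_derivative - 1 * (m + M) * sn m t) (at t within {-T..T})" for t
      by (rule has_real_derivative_even_homogeneous)
    have "- 1 * (m + M) * cs m t = 0 - m * ?v (- t) - M * ?v 0" for t
      by (simp add: cs_eq_vs algebra_simps)
    then show "((\<lambda>t. - 1 * (m + M) * sn m t) has_real_derivative 0 - m * ?v (- t) - M * ?v 0)
        (at t within {-T..T})" for t
      using has_real_derivative_even_homogeneous(2)[of 1 "m + M" m t] by simp
  qed (simp_all add: S)
  moreover have "unique_periodic_solution T m M (\<lambda>_. 0) (\<lambda>_. 0)"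
    using assms(4) by (simp add: greens_function_def)
  ultimately have "\<forall>t\<in>{-T..T}. ?v t = 0"
    unfolding unique_periodic_solution_def by blast
  then have "?v 0 = 0"
    by (rule bspec) (use assms(1) in simp)
  then show False by simp
qed

text \<open>For the even extension of \<open>p\<close> the periodic solution is even and explicit.
  Its value at \<open>t\<close> is expressed once through \<open>H\<close>, folded onto
  \<open>{0..T}\<close>, and once through the kernel.\<close>

lemma greens_function_even:
  assumes T: "0 < T" "T \<le> 1" and mM: "0 < m + M" and H: "greens_function T m M H"
    and p: "continuous_on {0..T} p" and t: "t \<in> {-T..T}"
  shows "integral {0..T} (\<lambda>s. (H t s + H t (- s)) * p s)
    = integral {0..T} (\<lambda>s. even_kernel T m M \<bar>t\<bar> s * p s)"
proof -
  define f where "f s = p \<bar>s\<bar>" for s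
  have f: "continuous_on {-T..T} f"
    unfolding f_def by (rule continuous_on_compose2[OF p]) (auto intro!: continuous_intros)
  have f_minus: "f (- s) = 1 * f s" for s
    by (simp add: f_def)
  have S: "sn m T \<noteq> 0" using sn_nonzero[OF T mM H] .
  \<comment> \<open>Makes the derivative vanish at \<open>T\<close>, which for an even function is
    the periodic condition on the derivative.\<close>
  define c where "c = vpar' m f T / ((m + M) * sn m T)"
  have c: "c * (m + M) * sn m T = vpar' m f T"
    using S mM by (simp add: c_def)
  define v where "v t = c * (1 - (m + M) * vs m t) + vpar m f t" for t
  define v1 where "v1 t = - c * (m + M) * sn m t + vpar' m f t" for t
  have v_minus: "v (- t) = v t" for t
    using vpar_minus[of f 1, OF f_minus] by (simp add: v_def)
  have "periodic_solution T m M f v"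
  proof (rule periodic_solution_C2[OF T, where ?v1.0 = v1])
    fix t
    assume t: "t \<in> {-T..T}"
    show "(v has_real_derivative v1 t) (at t within {-T..T})"
      unfolding v_def [abs_def] v1_def
      by (intro DERIV_add has_real_derivative_even_homogeneous has_real_derivative_vpar T f t)
    have "(v1 has_real_derivative - c * (m + M) * cs m t + (f t - m * vpar m f t))
        (at t within {-T..T})"
      unfolding v1_def [abs_def]
      by (intro DERIV_add has_real_derivative_even_homogeneous has_real_derivative_vpar T f t)
    also have "- c * (m + M) * cs m t + (f t - m * vpar m f t) = f t - m * v (- t) - M * v 0"
      unfolding v_minus by (simp add: v_def cs_eq_vs algebra_simps)
    finally show "(v1 has_real_derivative f t - m * v (- t) - M * v 0) (at t within {-T..T})" .
  next
    show "v1 (- T) = v1 T"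
      using vpar_minus(2)[of f 1, OF f_minus] c by (simp add: v1_def)
  qed (simp_all add: f v_minus)
  have "integral {0..T} (\<lambda>s. (H t s + H t (- s)) * p s)
      = integral {0..T} (\<lambda>s. H t s * f s + H t (- s) * f (- s))"
    by (rule integral_cong) (simp add: f_def algebra_simps)
  also have "\<dots> = integral {-T..T} (\<lambda>s. H t s * f s)"
  proof (rule integral_symmetric_interval[symmetric])
    show "continuous_on {-T..T} (\<lambda>s. H t s * f s)"
      using continuous_on_greens_function[OF H t] f by (rule continuous_on_mult)
  qed (rule T)
  also have "\<dots> = v t"
    using greens_function_represents[OF H f \<open>periodic_solution T m M f v\<close> t] by simp
  also have "\<dots> = v \<bar>t\<bar>"
    using v_minus by (simp add: abs_if)
  also have "\<dots> = integral {0..T} (\<lambda>s. even_kernel T m M \<bar>t\<bar> s * p s)"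
  proof -
    have f0: "continuous_on {0..x} f" if "x \<le> T" for x
      using f that T by (elim continuous_on_subset) auto
    have p_eq: "integral {0..x} (\<lambda>s. k s * f s) = integral {0..x} (\<lambda>s. k s * p s)" for k x
      by (rule integral_cong) (simp add: f_def)
    have "v \<bar>t\<bar> = (1 / (m + M) - vs m \<bar>t\<bar>) / sn m T * vpar' m f T + vpar m f \<bar>t\<bar>"
      using S mM by (simp add: v_def c_def divide_simps)
    also have "vpar' m f T = integral {0..T} (\<lambda>s. cs m (T - s) * p s)"
      using vpar_integral(2)[OF f0, of T] T p_eq by simp
    also have "vpar m f \<bar>t\<bar> = integral {0..T} (\<lambda>s. sn m (max (\<bar>t\<bar> - s) 0) * p s)"
      using vpar_integral(1)[OF f0, of "\<bar>t\<bar>"] t p_eq integral_max_kernel[OF p, of "\<bar>t\<bar>"] by auto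
    also have "(1 / (m + M) - vs m \<bar>t\<bar>) / sn m T * integral {0..T} (\<lambda>s. cs m (T - s) * p s) + \<dots>
        = integral {0..T} (\<lambda>s. (1 / (m + M) - vs m \<bar>t\<bar>) / sn m T * (cs m (T - s) * p s)
          + sn m (max (\<bar>t\<bar> - s) 0) * p s)"
      using p S by (subst Henstock_Kurzweil_Integration.integral_add)
        (auto intro!: integrable_continuous_interval continuous_intros)
    also have "\<dots> = integral {0..T} (\<lambda>s. even_kernel T m M \<bar>t\<bar> s * p s)"
      by (simp add: even_kernel_def algebra_simps)
    finally show ?thesis .
  qed
  finally show ?thesis .
qed

text \<open>The counterpart for the odd extension of \<open>q\<close>, which is continuous because
  \<open>q 0 = 0\<close>. The factor \<open>sgn t\<close> carries the oddness of the solution in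
  \<open>t\<close>.\<close>

lemma greens_function_odd:
  assumes T: "0 < T" "T \<le> 1" and m: "0 \<le> m" and H: "greens_function T m M H"
    and q: "continuous_on {0..T} q" "q 0 = 0" and t: "t \<in> {-T..T}"
  shows "integral {0..T} (\<lambda>s. (H t s - H t (- s)) * q s)
    = integral {0..T} (\<lambda>s. sgn t * odd_kernel T m \<bar>t\<bar> s * q s)"
proof -
  \<comment> \<open>The odd extension: for \<open>0 <= s\<close> the second term is
    \<open>q 0 = 0\<close>, for \<open>s <= 0\<close> the first one is.\<close>
  define f where "f s = q (max s 0) - q (max (- s) 0)" for s
  have f: "continuous_on {-T..T} f"
    unfolding f_def
    by (rule continuous_on_diff; rule continuous_on_compose2[OF q(1)])
      (use T in \<open>auto intro!: continuous_intros\<close>)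
  have f_minus: "f (- s) = (-1) * f s" for s
    by (simp add: f_def)
  have f_eq: "f s = q s" if "0 \<le> s" for s
    using that q(2) by (simp add: f_def max_def)
  have S: "sn (- m) T \<noteq> 0" using sn_neg_pos[OF m T(1)] by simp
  \<comment> \<open>Makes \<open>v T = 0\<close>, which for an odd function is the periodic
    condition on the values.\<close>
  define d where "d = - vpar (- m) f T / sn (- m) T"
  define v where "v t = d * sn (- m) t + vpar (- m) f t" for t
  define v1 where "v1 t = d * cs (- m) t + vpar' (- m) f t" for t
  have v_minus: "v (- t) = - v t" for t
    using vpar_minus[of f "-1", OF f_minus] by (simp add: v_def)
  have "periodic_solution T m M f v"
  proof (rule periodic_solution_C2[OF T, where ?v1.0 = v1])
    fix t
    assume t: "t \<in> {-T..T}"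
    show "(v has_real_derivative v1 t) (at t within {-T..T})"
      unfolding v_def [abs_def] v1_def
      by (intro DERIV_add DERIV_cmult has_real_derivative_sn has_real_derivative_vpar T f t)
    have "(v1 has_real_derivative d * (- (- m) * sn (- m) t) + (f t - (- m) * vpar (- m) f t))
        (at t within {-T..T})"
      unfolding v1_def [abs_def]
      by (intro DERIV_add DERIV_cmult has_real_derivative_cs has_real_derivative_vpar T f t)
    \<comment> \<open>The term with \<open>M\<close> drops out since \<open>v 0 = 0\<close>.\<close>
    also have "d * (- (- m) * sn (- m) t) + (f t - (- m) * vpar (- m) f t)
        = f t - m * v (- t) - M * v 0"
      unfolding v_minus by (simp add: v_def algebra_simps)
    finally show "(v1 has_real_derivative f t - m * v (- t) - M * v 0) (at t within {-T..T})" .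
  next
    show "v1 (- T) = v1 T"
      using vpar_minus(2)[of f "-1", OF f_minus] by (simp add: v1_def)
    show "v T = v (- T)"
      unfolding v_minus using S by (simp add: v_def d_def)
  qed (rule f)
  have "integral {0..T} (\<lambda>s. (H t s - H t (- s)) * q s)
      = integral {0..T} (\<lambda>s. H t s * f s + H t (- s) * f (- s))"
    by (rule integral_cong) (simp add: f_minus f_eq algebra_simps)
  also have "\<dots> = integral {-T..T} (\<lambda>s. H t s * f s)"
  proof (rule integral_symmetric_interval[symmetric])
    show "continuous_on {-T..T} (\<lambda>s. H t s * f s)"
      using continuous_on_greens_function[OF H t] f by (rule continuous_on_mult)
  qed (rule T)
  also have "\<dots> = v t"
    using greens_function_represents[OF H f \<open>periodic_solution T m M f v\<close> t] by simp
  also have "\<dots> = sgn t * v \<bar>t\<bar>"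
    using v_minus[of t] v_minus[of 0] by (auto simp: abs_if sgn_if)
  also have "v \<bar>t\<bar> = integral {0..T} (\<lambda>s. odd_kernel T m \<bar>t\<bar> s * q s)"
  proof -
    have f0: "continuous_on {0..x} f" if "x \<le> T" for x
      using f that T by (elim continuous_on_subset) auto
    have q_eq: "integral {0..x} (\<lambda>s. k s * f s) = integral {0..x} (\<lambda>s. k s * q s)" for k x
      by (rule integral_cong) (simp add: f_eq)
    have "v \<bar>t\<bar> = vpar (- m) f \<bar>t\<bar> - sn (- m) \<bar>t\<bar> / sn (- m) T * vpar (- m) f T"
      by (simp add: v_def d_def)
    also have "vpar (- m) f T = integral {0..T} (\<lambda>s. sn (- m) (T - s) * q s)"
      using vpar_integral(1)[OF f0, of T] T q_eq by simp
    also have "vpar (- m) f \<bar>t\<bar> = integral {0..T} (\<lambda>s. sn (- m) (max (\<bar>t\<bar> - s) 0) * q s)"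
      using vpar_integral(1)[OF f0, of "\<bar>t\<bar>"] t q_eq integral_max_kernel[OF q(1), of "\<bar>t\<bar>"] by auto
    also have "\<dots> - sn (- m) \<bar>t\<bar> / sn (- m) T * integral {0..T} (\<lambda>s. sn (- m) (T - s) * q s)
        = integral {0..T} (\<lambda>s. sn (- m) (max (\<bar>t\<bar> - s) 0) * q s
          - sn (- m) \<bar>t\<bar> / sn (- m) T * (sn (- m) (T - s) * q s))"
      using q S by (subst Henstock_Kurzweil_Integration.integral_diff)
        (auto intro!: integrable_continuous_interval continuous_intros)
    also have "\<dots> = integral {0..T} (\<lambda>s. odd_kernel T m \<bar>t\<bar> s * q s)"
      by (simp add: odd_kernel_def algebra_simps)
    finally show ?thesis .
  qed
  also have "sgn t * \<dots> = integral {0..T} (\<lambda>s. sgn t * odd_kernel T m \<bar>t\<bar> s * q s)"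
    by (simp add: mult.assoc)
  finally show ?thesis .
qed

subsection \<open>Comparison of the even and the odd kernel\<close>

lemma cs_antimono:
  assumes "0 \<le> m" "0 \<le> x" "x \<le> y" "sqrt m * y \<le> pi"
  shows "cs m y \<le> cs m x"
  using assms by (simp add: cs_def cos_monotone_0_pi_le mult_left_mono)

lemma vs_mono:
  assumes "0 \<le> m" "0 \<le> x" "x \<le> y" "sqrt m * y \<le> pi"
  shows "vs m x \<le> vs m y"
  using cs_antimono[OF assms] assms
  by (auto simp: vs_def divide_right_mono)

lemma cs_pos:
  assumes "0 \<le> m" "0 \<le> x" "sqrt m * x < pi / 2"
  shows "0 < cs m x"
proof -
  have "0 \<le> sqrt m * x" using assms by simp
  then have "0 < cos (sqrt m * x)"
    by (intro cos_gt_zero_pi) (use assms(3) pi_gt_zero in linarith)+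
  then show ?thesis using assms by (simp add: cs_def)
qed

lemma sn_pos:
  assumes "0 \<le> m" "0 < x" "sqrt m * x < pi"
  shows "0 < sn m x"
  using assms by (auto simp: sn_def intro!: divide_pos_pos sin_gt_zero)

text \<open>For \<open>s <= t\<close> the left side is the amount by which the numerator of the even
  kernel, taken at the critical \<open>M\<close>, exceeds its value on the diagonal at
  \<open>s\<close>. The right side makes its sign visible.\<close>

lemma sn_mult_sn_diff:
  "sn m T * sn m (t - s) - cs m (T - s) * (vs m t - vs m s) = cs m s * (vs m (T - s) - vs m (T - t))"
proof (cases "m = 0")
  case True
  then show ?thesis
    by (simp add: sn_def cs_def vs_def power2_eq_square field_simps)
next
  case False
  have "m * (sn m T * sn m (t - s)) - cs m (T - s) * (cs m s - cs m t)
      = cs m s * (cs m (T - t) - cs m (T - s))"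
    by (simp add: cs_diff sn_diff algebra_simps)
  then have "m * (sn m T * sn m (t - s) - cs m (T - s) * (vs m t - vs m s))
      = m * (cs m s * (vs m (T - s) - vs m (T - t)))"
    by (simp add: cs_eq_vs algebra_simps)
  then show ?thesis using False by simp
qed

text \<open>The comparison of the kernels at the critical value \<open>1 / (m + M) = vs m T\<close>,
  cleared of the denominators \<open>sn m T\<close> and \<open>sn (- m) T\<close>. Both cases reduce
  to the diagonal at \<open>min t s\<close>.\<close>

lemma even_kernel_numerator_ge:
  assumes m: "0 \<le> m" and T: "sqrt m * T < pi / 2" and t: "0 \<le> t" "t \<le> T" and s: "0 \<le> s" "s \<le> T"
  shows "sn (- m) (min t s) * sn (- m) (T - max t s) * sn m T
    \<le> (cs m (T - s) * (vs m T - vs m t) + sn m T * sn m (max (t - s) 0)) * sn (- m) T"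
proof (cases "T = 0")
  case True
  then show ?thesis by simp
next
  case False
  with t have T0: "0 < T" by simp
  have small: "sqrt m * x < pi / 2" "sqrt m * x \<le> pi" if "x \<le> T" for x
  proof -
    have "sqrt m * x \<le> sqrt m * T" using that m by (simp add: mult_left_mono)
    then show "sqrt m * x < pi / 2" "sqrt m * x \<le> pi" using T pi_gt_zero by linarith+
  qed
  have ShT: "0 < sn (- m) T" using sn_neg_pos[OF m T0] .
  have S: "0 < sn m T" using sn_pos[OF m T0] T pi_gt_zero by simp
  \<comment> \<open>Off the diagonal the odd side only gets smaller, as \<open>sn (- m)\<close> is
    monotone; on it, \<open>sn_diagonal_le\<close> applies with \<open>u = T - x\<close>.\<close>
  have diag: "sn (- m) x * sn (- m) (T - y) * sn m T \<le> cs m (T - x) * (vs m T - vs m x) * sn (- m) T"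
    if "0 \<le> x" "x \<le> y" "y \<le> T" for x y
  proof -
    have "sn (- m) x * sn (- m) (T - y) \<le> sn (- m) x * sn (- m) (T - x)"
      using that m by (intro mult_left_mono sn_neg_mono sn_neg_nonneg) auto
    then have "sn (- m) x * sn (- m) (T - y) * sn m T \<le> sn (- m) x * sn (- m) (T - x) * sn m T"
      using S by (intro mult_right_mono) auto
    also have "\<dots> \<le> cs m (T - x) * (vs m T - vs m x) * sn (- m) T"
      using sn_diagonal_le[of m x "T - x"] m T that by simp
    finally show ?thesis .
  qed
  show ?thesis
  proof (cases "t \<le> s")
    case True
    \<comment> \<open>On this side of the diagonal only \<open>cs m (T - s)\<close> varies with
      \<open>s\<close>, and it does not decrease.\<close>
    have "cs m (T - t) * (vs m T - vs m t) \<le> cs m (T - s) * (vs m T - vs m t)"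
      using True t s m small vs_mono[of m t T]
      by (intro mult_right_mono cs_antimono) auto
    then have "cs m (T - t) * (vs m T - vs m t) * sn (- m) T \<le> cs m (T - s) * (vs m T - vs m t) * sn (- m) T"
      by (rule mult_right_mono) (use ShT in simp)
    then show ?thesis
      using diag[of t s] True t s by (simp add: min_def max_def split: if_splits)
  next
    case False
    have "0 \<le> cs m s * (vs m (T - s) - vs m (T - t))"
      using False t s m small vs_mono[of m "T - t" "T - s"] cs_pos[of m s]
      by (intro mult_nonneg_nonneg) auto
    then have "cs m (T - s) * (vs m T - vs m s)
        \<le> cs m (T - s) * (vs m T - vs m t) + sn m T * sn m (t - s)"
      unfolding sn_mult_sn_diff[symmetric] by (simp add: algebra_simps)
    then have "cs m (T - s) * (vs m T - vs m s) * sn (- m) T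
        \<le> (cs m (T - s) * (vs m T - vs m t) + sn m T * sn m (t - s)) * sn (- m) T"
      by (rule mult_right_mono) (use ShT in simp)
    then show ?thesis
      using diag[of s t] False t s by (simp add: min_def max_def)
  qed
qed

text \<open>The symmetric form of the Dirichlet Green's function, which displays its sign.\<close>

lemma odd_kernel_eq:
  assumes "sn (- m) T \<noteq> 0"
  shows "odd_kernel T m t s = - (sn (- m) (min t s) * sn (- m) (T - max t s) / sn (- m) T)"
proof (cases "t \<le> s")
  case True
  then show ?thesis by (simp add: odd_kernel_def)
next
  case False
  have "sn (- m) T * sn (- m) (t - s) - sn (- m) t * sn (- m) (T - s) = - (sn (- m) s * sn (- m) (T - t))"
    by (simp add: sn_diff algebra_simps)
  moreover have "odd_kernel T m t s
      = (sn (- m) T * sn (- m) (t - s) - sn (- m) t * sn (- m) (T - s)) / sn (- m) T"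
    using assms False by (simp add: odd_kernel_def diff_divide_distrib)
  ultimately show ?thesis using False by simp
qed

lemma odd_kernel_less_even_kernel:
  assumes m: "0 \<le> m" and mM: "0 < m + M" and T: "0 < T" "sqrt m * T < pi / 2"
    and small: "(m + M) * vs m T < 1" and t: "t \<in> {0..T}" and s: "s \<in> {0..T}"
  shows "\<bar>odd_kernel T m t s\<bar> < even_kernel T m M t s"
proof -
  have ShT: "0 < sn (- m) T" using sn_neg_pos[OF m T(1)] .
  have S: "0 < sn m T" using sn_pos[OF m T(1)] T pi_gt_zero by simp
  have "sqrt m * (T - s) \<le> sqrt m * T" using m s by (simp add: mult_left_mono)
  then have C: "0 < cs m (T - s)" using m s T by (intro cs_pos) auto
  have "vs m T < 1 / (m + M)" using small mM by (simp add: field_simps)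
  have "\<bar>odd_kernel T m t s\<bar> = sn (- m) (min t s) * sn (- m) (T - max t s) / sn (- m) T"
    unfolding odd_kernel_eq[OF less_imp_neq[OF ShT, symmetric]] abs_minus_cancel
    using ShT sn_neg_nonneg[OF m] t s by (intro abs_of_nonneg divide_nonneg_pos mult_nonneg_nonneg) auto
  also have "\<dots> \<le> (cs m (T - s) * (vs m T - vs m t) + sn m T * sn m (max (t - s) 0)) / sn m T"
    using even_kernel_numerator_ge[OF m T(2), of t s] t s S ShT
    by (simp add: divide_simps mult.commute)
  also have "\<dots> = cs m (T - s) * (vs m T - vs m t) / sn m T + sn m (max (t - s) 0)"
    using S by (simp add: add_divide_distrib)
  \<comment> \<open>Strictness enters here: \<open>vs m T\<close> is replaced by the larger
    \<open>1 / (m + M)\<close> next to the positive factor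
    \<open>cs m (T - s) / sn m T\<close>.\<close>
  also have "\<dots> < even_kernel T m M t s"
    unfolding even_kernel_def using C S \<open>vs m T < 1 / (m + M)\<close>
    by (simp add: divide_strict_right_mono)
  finally show ?thesis .
qed

subsection \<open>The first Dirichlet eigenvalue\<close>

text \<open>In terms of \<open>vs\<close> the formula is uniform in \<open>m\<close>:
  \<open>vs 0 T\<close> is half the square of \<open>T\<close>, and for \<open>m > 0\<close>, with
  \<open>c = cos (sqrt m * T)\<close>, the value is \<open>m * c / (1 - c)\<close>.\<close>

lemma lambda1_eq:
  assumes "0 < T" "0 \<le> m" "m = 0 \<or> cos (sqrt m * T) \<in> {0<..<1}"
  shows "lambda1 T m = 1 / vs m T - m" and "0 < vs m T" and "0 < lambda1 T m"
proof -
  have "lambda1 T m = 1 / vs m T - m \<and> 0 < vs m T \<and> 0 < lambda1 T m"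
  proof (cases "m = 0")
    case True
    then show ?thesis using assms(1) by (simp add: lambda1_def vs_def)
  next
    case False
    define c where "c = cos (sqrt m * T)"
    have c: "0 < c" "c < 1" using assms(3) False by (auto simp: c_def)
    have vs: "vs m T = (1 - c) / m"
      using False assms(2) by (simp add: vs_def cs_def c_def)
    have l: "lambda1 T m = m * c / (1 - c)"
    proof -
      have "lambda1 T m = m / (- 1 + 1 / c)" using False by (simp add: lambda1_def c_def)
      also have "\<dots> = m * c / (1 - c)" using c by (simp add: field_simps)
      finally show ?thesis .
    qed
    show ?thesis
      unfolding vs l using c False assms(2) by (simp add: field_simps)
  qed
  then show "lambda1 T m = 1 / vs m T - m" "0 < vs m T" "0 < lambda1 T m" by auto
qed

lemma less_lambda1_iff:
  assumes "0 < T" "0 \<le> m" "sqrt m * T < pi / 2"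
  shows "M < lambda1 T m \<longleftrightarrow> (m + M) * vs m T < 1"
proof -
  have "m = 0 \<or> cos (sqrt m * T) \<in> {0<..<1}"
  proof (cases "m = 0")
    case False
    then have "0 < sqrt m * T" using assms by simp
    then have "0 < cos (sqrt m * T)" "cos (sqrt m * T) < cos 0"
      using assms(3) pi_gt_zero by (intro cos_gt_zero cos_monotone_0_pi; linarith)+
    then show ?thesis by simp
  qed simp
  from lambda1_eq[OF assms(1,2) this] show ?thesis
    by (simp add: less_diff_eq pos_less_divide_eq add.commute)
qed

text \<open>Two combinations of \<open>y\<close> and \<open>y1\<close> with \<open>cs\<close> and
  \<open>sn\<close> are constant along solutions, hence 0; the Pythagorean identity recovers
  \<open>y\<close>. Derivatives are taken only inside the interval, because for \<open>T = 1\<close>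
  an admissible function has no prescribed second derivative at the right end.\<close>

lemma linear_ode_unique:
  fixes y y1 :: "real \<Rightarrow> real"
  assumes "0 < T"
    and y: "\<And>t. 0 < t \<Longrightarrow> t < T \<Longrightarrow> (y has_real_derivative y1 t) (at t)"
    and y1: "\<And>t. 0 < t \<Longrightarrow> t < T \<Longrightarrow> (y1 has_real_derivative - m * y t) (at t)"
    and cont: "continuous_on {0..T} y" "continuous_on {0..T} y1"
    and init: "y 0 = 0" "y1 0 = 0" and t: "t \<in> {0..T}"
  shows "y t = 0"
proof -
  have "y1 t * cs m t + m * (y t * sn m t) = y1 0 * cs m 0 + m * (y 0 * sn m 0)"
  proof (rule DERIV_isconst2[OF assms(1)])
    fix x
    assume x: "0 < x" "x < T"
    show "((\<lambda>t. y1 t * cs m t + m * (y t * sn m t)) has_real_derivative 0) (at x)"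
      by (rule DERIV_cong[OF DERIV_add[OF DERIV_mult'[OF y1[OF x] has_real_derivative_cs]
              DERIV_cmult[OF DERIV_mult'[OF y[OF x] has_real_derivative_sn]]]])
        (simp add: algebra_simps)
  qed (use t cont in \<open>auto intro!: continuous_intros\<close>)
  moreover have "y t * cs m t - y1 t * sn m t = y 0 * cs m 0 - y1 0 * sn m 0"
  proof (rule DERIV_isconst2[OF assms(1)])
    fix x
    assume x: "0 < x" "x < T"
    show "((\<lambda>t. y t * cs m t - y1 t * sn m t) has_real_derivative 0) (at x)"
      by (rule DERIV_cong[OF DERIV_diff[OF DERIV_mult'[OF y[OF x] has_real_derivative_cs]
              DERIV_mult'[OF y1[OF x] has_real_derivative_sn]]])
        (simp add: algebra_simps)
  qed (use t cont in \<open>auto intro!: continuous_intros\<close>)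
  ultimately have "y1 t * cs m t + m * (y t * sn m t) = 0" "y t * cs m t - y1 t * sn m t = 0"
    using init by simp_all
  moreover have "y t * ((cs m t)\<^sup>2 + m * (sn m t)\<^sup>2)
      = (y t * cs m t - y1 t * sn m t) * cs m t + (y1 t * cs m t + m * (y t * sn m t)) * sn m t"
    by (simp add: algebra_simps power2_eq_square)
  ultimately show ?thesis by (simp add: cs_sn_pythagoras)
qed

text \<open>\<open>y * y1\<close> has derivative \<open>m * y^2 + y1^2 >= 0\<close> and vanishes at
  both ends, hence throughout. So \<open>y^2\<close> is constant.\<close>

lemma dirichlet_ode_unique:
  fixes y y1 :: "real \<Rightarrow> real"
  assumes "0 < T" "0 \<le> m"
    and y: "\<And>t. 0 < t \<Longrightarrow> t < T \<Longrightarrow> (y has_real_derivative y1 t) (at t)"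
    and y1: "\<And>t. 0 < t \<Longrightarrow> t < T \<Longrightarrow> (y1 has_real_derivative m * y t) (at t)"
    and cont: "continuous_on {0..T} y" "continuous_on {0..T} y1"
    and bc: "y 0 = 0" "y T = 0" and t: "t \<in> {0..T}"
  shows "y t = 0"
proof -
  have mono: "y a * y1 a \<le> y b * y1 b" if "0 \<le> a" "a \<le> b" "b \<le> T" for a b
  proof (rule DERIV_nonneg_imp_increasing_open[OF that(2)])
    fix x
    assume "a < x" "x < b"
    with that have x: "0 < x" "x < T" by auto
    have "((\<lambda>t. y t * y1 t) has_real_derivative (y x * (m * y x) + y1 x * y1 x)) (at x)"
      by (rule DERIV_mult'[OF y[OF x] y1[OF x]])
    moreover have "0 \<le> y x * (m * y x) + y1 x * y1 x"
      using assms(2) by (simp add: mult.left_commute)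
    ultimately show "\<exists>d. ((\<lambda>t. y t * y1 t) has_real_derivative d) (at x) \<and> 0 \<le> d" by blast
  next
    show "continuous_on {a..b} (\<lambda>t. y t * y1 t)"
      by (rule continuous_on_subset[OF continuous_on_mult[OF cont]]) (use that in auto)
  qed
  have zero: "y x * y1 x = 0" if "0 \<le> x" "x \<le> T" for x
    using mono[of 0 x] mono[of x T] that bc by simp
  have "y t * y t = y 0 * y 0"
  proof (rule DERIV_isconst2[OF assms(1)])
    fix x
    assume x: "0 < x" "x < T"
    show "((\<lambda>t. y t * y t) has_real_derivative 0) (at x)"
      by (rule DERIV_cong[OF DERIV_mult'[OF y[OF x] y[OF x]]]) (use zero[of x] x in \<open>simp add: mult.commute\<close>)
  qed (use t cont in \<open>auto intro!: continuous_intros\<close>)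
  then show ?thesis using bc by simp
qed

text \<open>The residual \<open>g\<close> is continuous on the open interval, so the set where it is
  nonzero is open; being null, it is empty.\<close>

lemma solves_equation_interior:
  assumes "0 < T" "T \<le> 1" "admissible T z z1 z2" "solves_equation T m M (\<lambda>_. 0) z z2"
    and t: "t \<in> {-T<..<T}"
  shows "z2 t = - m * z (- t) - M * z 0"
proof (rule ccontr)
  assume neq: "z2 t \<noteq> - m * z (- t) - M * z 0"
  define g where "g x = z2 x + m * z (- x) + M * z 0" for x
  define U where "U = {-T<..<T} \<inter> g -` (- {0})"
  have "continuous_on {-T..T} z"
    using assms(3) unfolding admissible_def by (blast intro: DERIV_continuous_on)
  then have "continuous_on {-T<..<T} (\<lambda>x. z (- x))"
    by (rule continuous_on_compose2) (auto intro!: continuous_intros)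
  moreover have "continuous_on {-T<..<T} z2"
    using assms(3) unfolding admissible_def
    by (auto split: if_splits elim: continuous_on_subset)
  ultimately have "continuous_on {-T<..<T} g"
    unfolding g_def [abs_def] by (intro continuous_intros)
  then have "open U"
    unfolding U_def by (rule continuous_open_preimage) auto
  have "AE x in lebesgue_on {-T..T}. g x = 0"
    using assms(4) AE_trunc_eq_0[OF assms(2)] unfolding solves_equation_def
    by eventually_elim (simp add: g_def)
  then have "AE x in lebesgue. x \<in> {-T..T} \<longrightarrow> g x = 0"
    by (simp add: AE_restrict_space_iff)
  then have "AE x\<in>U in lebesgue. x \<in> {}"
    by eventually_elim (auto simp: U_def)
  moreover have "t \<in> U"
    using t neq by (simp add: U_def g_def algebra_simps)
  \<comment> \<open>A closed set containing almost every point of an open set contains all of it;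
    the closed set is taken to be empty.\<close>
  ultimately show False
    using mem_closed_if_AE_lebesgue_open[OF \<open>open U\<close>, of "{}" t] by simp
qed

text \<open>The odd part of an eigenfunction \<open>z\<close> vanishes, and its even part is
  \<open>z 0\<close> times the even homogeneous solution, which therefore vanishes at
  \<open>T\<close>. Conversely, that solution is then an eigenfunction.\<close>

lemma dirichlet_eigenvalue_iff:
  assumes T: "0 < T" "T \<le> 1" and m: "0 \<le> m"
  shows "dirichlet_eigenvalue T m \<mu> \<longleftrightarrow> (m + \<mu>) * vs m T = 1"
proof
  assume "dirichlet_eigenvalue T m \<mu>"
  then obtain z z1 z2 where adm: "admissible T z z1 z2"
    and sol: "solves_equation T m \<mu> (\<lambda>_. 0) z z2"
    and bc: "z (- T) = 0" "z T = 0" and nontriv: "\<exists>t\<in>{-T..T}. z t \<noteq> 0"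
    unfolding dirichlet_eigenvalue_def by blast
  have z2: "z2 t = - m * z (- t) - \<mu> * z 0" if "t \<in> {-T<..<T}" for t
    using solves_equation_interior[OF T adm sol that] .
  have cz1: "continuous_on {-T..T} z1"
    and dz: "\<And>t. t \<in> {-T..T} \<Longrightarrow> (z has_real_derivative z1 t) (at t within {-T..T})"
    and dz1: "\<And>t. t \<in> {-T..<T} \<Longrightarrow> (z1 has_real_derivative z2 t) (at t within {-T..T})"
    using adm unfolding admissible_def by (auto split: if_splits)
  have cz: "continuous_on {-T..T} z" using dz by (rule DERIV_continuous_on)
  have D: "(z has_real_derivative z1 t) (at t)" "(z1 has_real_derivative z2 t) (at t)"
    if "- T < t" "t < T" for t
    using dz[of t] dz1[of t] that by (simp_all add: at_within_Icc_at)
  have D_minus: "((\<lambda>t. z (- t)) has_real_derivative - z1 (- t)) (at t)"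
    "((\<lambda>t. z1 (- t)) has_real_derivative - z2 (- t)) (at t)" if "- T < t" "t < T" for t
  proof -
    have n: "(uminus has_real_derivative - 1) (at t)"
      by (rule DERIV_cong[OF DERIV_minus[OF DERIV_ident]]) simp
    have "(z has_real_derivative z1 (- t)) (at (- t))" "(z1 has_real_derivative z2 (- t)) (at (- t))"
      using D[of "- t"] that by simp_all
    from DERIV_chain2[OF this(1) n] DERIV_chain2[OF this(2) n]
    show "((\<lambda>t. z (- t)) has_real_derivative - z1 (- t)) (at t)"
      "((\<lambda>t. z1 (- t)) has_real_derivative - z2 (- t)) (at t)" by simp_all
  qed
  have C: "continuous_on {0..T} z" "continuous_on {0..T} z1"
    "continuous_on {0..T} (\<lambda>t. z (- t))" "continuous_on {0..T} (\<lambda>t. z1 (- t))"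
    using T by (auto intro: continuous_on_subset[OF cz] continuous_on_subset[OF cz1]
        intro!: continuous_on_compose2[OF cz] continuous_on_compose2[OF cz1] continuous_intros)
  \<comment> \<open>The even part minus its candidate has zero initial data and solves
    \<open>y'' + m y = 0\<close>, since the terms \<open>\<mu> * z 0\<close> cancel.\<close>
  have even: "(z t + z (- t)) / 2 - z 0 * (1 - (m + \<mu>) * vs m t) = 0" if "t \<in> {0..T}" for t
  proof (rule linear_ode_unique[OF T(1), where m = m
        and y = "\<lambda>t. (z t + z (- t)) / 2 - z 0 * (1 - (m + \<mu>) * vs m t)"
        and ?y1.0 = "\<lambda>t. (z1 t - z1 (- t)) / 2 - (- z 0 * (m + \<mu>) * sn m t)"])
    fix t
    assume "0 < t" "t < T"
    then have t: "- T < t" "t < T" by auto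
    show "((\<lambda>t. (z t + z (- t)) / 2 - z 0 * (1 - (m + \<mu>) * vs m t)) has_real_derivative
        (z1 t - z1 (- t)) / 2 - (- z 0 * (m + \<mu>) * sn m t)) (at t)"
      using DERIV_diff[OF DERIV_cdivide[OF DERIV_add[OF D(1)[OF t] D_minus(1)[OF t]], of 2]
          has_real_derivative_even_homogeneous(1)[of "z 0" "m + \<mu>" m]] by simp
    have "((\<lambda>t. (z1 t - z1 (- t)) / 2 - (- z 0 * (m + \<mu>) * sn m t)) has_real_derivative
        (z2 t - (- z2 (- t))) / 2 - (- z 0 * (m + \<mu>) * cs m t)) (at t)"
      by (rule DERIV_diff[OF DERIV_cdivide[OF DERIV_diff[OF D(2)[OF t] D_minus(2)[OF t]], of 2]
          has_real_derivative_even_homogeneous(2)[of "z 0" "m + \<mu>" m]])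
    also have "(z2 t - (- z2 (- t))) / 2 - (- z 0 * (m + \<mu>) * cs m t)
        = - m * ((z t + z (- t)) / 2 - z 0 * (1 - (m + \<mu>) * vs m t))"
      using z2[of t] z2[of "- t"] t by (simp add: cs_eq_vs field_simps)
    finally show "((\<lambda>t. (z1 t - z1 (- t)) / 2 - (- z 0 * (m + \<mu>) * sn m t)) has_real_derivative
        - m * ((z t + z (- t)) / 2 - z 0 * (1 - (m + \<mu>) * vs m t))) (at t)" .
  qed (use that C in \<open>auto intro!: continuous_intros\<close>)
  \<comment> \<open>The term \<open>\<mu> * z 0\<close> cancels as well, leaving
    \<open>y'' = m y\<close> with zero values at 0 and \<open>T\<close>.\<close>
  have odd: "(z t - z (- t)) / 2 = 0" if "t \<in> {0..T}" for t
  proof (rule dirichlet_ode_unique[OF T(1) m, where y = "\<lambda>t. (z t - z (- t)) / 2"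
        and ?y1.0 = "\<lambda>t. (z1 t + z1 (- t)) / 2"])
    fix t
    assume "0 < t" "t < T"
    then have t: "- T < t" "t < T" by auto
    show "((\<lambda>t. (z t - z (- t)) / 2) has_real_derivative (z1 t + z1 (- t)) / 2) (at t)"
      using DERIV_cdivide[OF DERIV_diff[OF D(1)[OF t] D_minus(1)[OF t]], of 2] by simp
    have "((\<lambda>t. (z1 t + z1 (- t)) / 2) has_real_derivative (z2 t + (- z2 (- t))) / 2) (at t)"
      by (rule DERIV_cdivide[OF DERIV_add[OF D(2)[OF t] D_minus(2)[OF t]]])
    also have "(z2 t + (- z2 (- t))) / 2 = m * ((z t - z (- t)) / 2)"
      using z2[of t] z2[of "- t"] t by (simp add: field_simps)
    finally show "((\<lambda>t. (z1 t + z1 (- t)) / 2) has_real_derivative m * ((z t - z (- t)) / 2)) (at t)" .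
  qed (use that C bc in \<open>auto intro!: continuous_intros\<close>)
  have z_eq: "z t = z 0 * (1 - (m + \<mu>) * vs m t)" "z (- t) = z 0 * (1 - (m + \<mu>) * vs m t)"
    if "t \<in> {0..T}" for t
    using even[OF that] odd[OF that] by simp_all
  have "z 0 \<noteq> 0"
  proof
    assume z0: "z 0 = 0"
    have "z t = 0" if "t \<in> {-T..T}" for t
      using z_eq(1)[of t] z_eq(2)[of "- t"] that z0 by (cases "0 \<le> t") auto
    then show False using nontriv by blast
  qed
  then show "(m + \<mu>) * vs m T = 1"
    using z_eq(1)[of T] T bc by simp
next
  assume eq: "(m + \<mu>) * vs m T = 1"
  let ?z = "\<lambda>t. 1 * (1 - (m + \<mu>) * vs m t)"
  have "admissible T ?z (\<lambda>t. - 1 * (m + \<mu>) * sn m t) (\<lambda>t. - 1 * (m + \<mu>) * cs m t)"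
    by (intro admissible_C2 T has_real_derivative_even_homogeneous continuous_intros)
  moreover have "solves_equation T m \<mu> (\<lambda>_. 0) ?z (\<lambda>t. - 1 * (m + \<mu>) * cs m t)"
    by (rule solves_equationI[OF T(2)]) (simp add: cs_eq_vs algebra_simps)
  moreover have "\<exists>t\<in>{-T..T}. ?z t \<noteq> 0"
    using T by (intro bexI[of _ 0]) auto
  moreover have "?z (- T) = 0" "?z T = 0"
    using eq by simp_all
  ultimately show "dirichlet_eigenvalue T m \<mu>"
    unfolding dirichlet_eigenvalue_def by blast
qed

text \<open>The eigenvalue equation is linear in \<open>\<mu>\<close> and has a single root, so the
  only eigenvalue is also the first positive one.\<close>

lemma first_dirichlet_eigenvalue_lambda1:
  assumes T: "0 < T" "T \<le> 1" and m: "0 \<le> m" "m = 0 \<or> cos (sqrt m * T) \<in> {0<..<1}"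
  shows "first_dirichlet_eigenvalue T m (lambda1 T m)"
proof -
  have "dirichlet_eigenvalue T m \<mu> \<longleftrightarrow> \<mu> = lambda1 T m" for \<mu>
  proof -
    have "(m + \<mu>) * vs m T = 1 \<longleftrightarrow> m + \<mu> = 1 / vs m T"
      using lambda1_eq(2)[OF T(1) m] by (simp add: field_simps)
    then show ?thesis
      unfolding dirichlet_eigenvalue_iff[OF T m(1)] lambda1_eq(1)[OF T(1) m] by auto
  qed
  then show ?thesis
    using lambda1_eq(3)[OF T(1) m] by (simp add: first_dirichlet_eigenvalue_def)
qed

subsection \<open>Positivity\<close>

text \<open>The integral identities become pointwise because both sides are continuous in
  \<open>s\<close>.\<close>

lemma greens_function_kernels:
  assumes T: "0 < T" "T \<le> 1" and m: "0 \<le> m" and mM: "0 < m + M" and H: "greens_function T m M H"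
    and t: "t \<in> {-T..T}" and s: "s \<in> {0..T}"
  shows "H t s + H t (- s) = even_kernel T m M \<bar>t\<bar> s"
    and "H t s - H t (- s) = sgn t * odd_kernel T m \<bar>t\<bar> s"
proof -
  have S: "sn m T \<noteq> 0" "sn (- m) T \<noteq> 0"
    using sn_nonzero[OF T mM H] sn_neg_pos[OF m T(1)] by simp_all
  have C: "continuous_on {0..T} (H t)" "continuous_on {0..T} (\<lambda>s. H t (- s))"
    using T by (auto intro: continuous_on_subset[OF continuous_on_greens_function[OF H t]]
        intro!: continuous_on_compose2[OF continuous_on_greens_function[OF H t]] continuous_intros)
  have ce: "continuous_on {0..T} (even_kernel T m M \<bar>t\<bar>)"
    unfolding even_kernel_def [abs_def] using S by (intro continuous_intros) auto
  have co: "continuous_on {0..T} (\<lambda>s. sgn t * odd_kernel T m \<bar>t\<bar> s)"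
    unfolding odd_kernel_def using S by (intro continuous_intros) auto
  \<comment> \<open>The difference of the two sides is the test function; it must vanish at 0 to
    have a continuous odd extension.\<close>
  have odd_0: "H t 0 - H t (- 0) - sgn t * odd_kernel T m \<bar>t\<bar> 0 = 0"
    using S by (simp add: odd_kernel_def)
  show "H t s + H t (- s) = even_kernel T m M \<bar>t\<bar> s"
    by (rule continuous_eq_if_integrals_eq[OF T(1) _ _ _ s]; (rule greens_function_even[OF T mM H _ t])?)
      (intro continuous_on_add continuous_on_diff C ce)+
  show "H t s - H t (- s) = sgn t * odd_kernel T m \<bar>t\<bar> s"
  proof (rule continuous_eq_if_integrals_eq[OF T(1) _ co _ s])
    show "continuous_on {0..T} (\<lambda>s. H t s - H t (- s))"
      by (intro continuous_on_diff C)
    then have "continuous_on {0..T} (\<lambda>s. H t s - H t (- s) - sgn t * odd_kernel T m \<bar>t\<bar> s)"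
      using co by (rule continuous_on_diff)
    from greens_function_odd[OF T m H this odd_0 t]
    show "integral {0..T} (\<lambda>s. (H t s - H t (- s)) * (H t s - H t (- s) - sgn t * odd_kernel T m \<bar>t\<bar> s))
      = integral {0..T} (\<lambda>s. sgn t * odd_kernel T m \<bar>t\<bar> s * (H t s - H t (- s) - sgn t * odd_kernel T m \<bar>t\<bar> s))" .
  qed
qed

lemma positive_kernel_iff:
  assumes T: "0 < T" "T \<le> 1" and m: "0 \<le> m" and mM: "0 < m + M" and H: "greens_function T m M H"
  shows "positive_kernel T H \<longleftrightarrow> sqrt m * T < pi / 2 \<and> (m + M) * vs m T < 1"
proof
  assume pos: "positive_kernel T H"
  have E: "0 < even_kernel T m M t s" if "t \<in> {0..T}" "s \<in> {0..T}" for t s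
  proof -
    have "0 < H t s" "0 < H t (- s)"
      using pos that unfolding positive_kernel_def by auto
    then show ?thesis
      using greens_function_kernels(1)[OF T m mM H, of t s] that by simp
  qed
  \<comment> \<open>At \<open>(0, T)\<close> the even kernel is
    \<open>1 / ((m + M) * sn m T)\<close>.\<close>
  have S: "0 < sn m T"
    using E[of 0 T] T mM by (simp add: even_kernel_def zero_less_divide_iff zero_less_mult_iff)
  \<comment> \<open>At \<open>(0, T - x)\<close> it is
    \<open>cs m x / ((m + M) * sn m T)\<close>.\<close>
  have C: "0 < cs m x" if "x \<in> {0..T}" for x
    using E[of 0 "T - x"] that mult_pos_pos[OF mM S]
    by (simp add: even_kernel_def zero_less_divide_iff)
  have "sqrt m * T < pi / 2"
  proof (rule ccontr)
    assume "\<not> sqrt m * T < pi / 2"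
    then have ge: "pi / 2 \<le> sqrt m * T" by simp
    then have "0 < sqrt m" using pi_gt_zero m by (cases "m = 0") auto
    \<comment> \<open>The first positive zero of \<open>cs m\<close> would lie in
      \<open>{0..T}\<close>.\<close>
    with ge have "pi / 2 / sqrt m \<in> {0..T}" by (simp add: field_simps)
    from C[OF this] show False
      using m \<open>0 < sqrt m\<close> by (simp add: cs_def)
  qed
  moreover have "(m + M) * vs m T < 1"
  proof -
    \<comment> \<open>At \<open>(T, T)\<close> only the first summand of the even kernel is
      left.\<close>
    have "0 < (1 / (m + M) - vs m T) / sn m T"
      using E[of T T] T by (simp add: even_kernel_def)
    then have "vs m T < 1 / (m + M)"
      using S by (simp add: zero_less_divide_iff)
    then show ?thesis
      using mM by (simp add: field_simps)
  qed
  ultimately show "sqrt m * T < pi / 2 \<and> (m + M) * vs m T < 1" ..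
next
  assume R: "sqrt m * T < pi / 2 \<and> (m + M) * vs m T < 1"
  show "positive_kernel T H"
    unfolding positive_kernel_def
  proof (intro ballI)
    fix t s
    assume t: "t \<in> {-T..T}" and s: "s \<in> {-T..T}"
    let ?e = "even_kernel T m M \<bar>t\<bar> \<bar>s\<bar>" and ?o = "odd_kernel T m \<bar>t\<bar> \<bar>s\<bar>"
    have "\<bar>?o\<bar> < ?e"
      using odd_kernel_less_even_kernel[OF m mM T(1)] R t s by auto
    moreover have "\<bar>sgn t * ?o\<bar> \<le> \<bar>?o\<bar>"
      by (simp add: abs_mult sgn_if)
    moreover have "H t \<bar>s\<bar> + H t (- \<bar>s\<bar>) = ?e" "H t \<bar>s\<bar> - H t (- \<bar>s\<bar>) = sgn t * ?o"
      using greens_function_kernels[OF T m mM H t, of "\<bar>s\<bar>"] s by auto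
    \<comment> \<open>Twice these values are \<open>?e + sgn t * ?o\<close> and
      \<open>?e - sgn t * ?o\<close>.\<close>
    ultimately have "0 < H t \<bar>s\<bar>" "0 < H t (- \<bar>s\<bar>)" by linarith+
    then show "0 < H t s" by (cases "0 \<le> s") auto
  qed
qed

theorem corollary6p9:
  fixes T m M :: real and H :: "real \<Rightarrow> real \<Rightarrow> real"
  assumes "0 < T" and "T \<le> 1"
    and "0 \<le> m" and "0 \<le> M" and "0 < m + M"
    and "greens_function T m M H"
  shows "(positive_kernel T H \<longleftrightarrow> sqrt m * T < pi / 2 \<and> M \<in> {-m<..<lambda1 T m}) \<and>
    (m = 0 \<or> cos (sqrt m * T) \<in> {0<..<1} \<longrightarrow> first_dirichlet_eigenvalue T m (lambda1 T m))"
proof (intro conjI impI)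
  show "positive_kernel T H \<longleftrightarrow> sqrt m * T < pi / 2 \<and> M \<in> {-m<..<lambda1 T m}"
    unfolding positive_kernel_iff[OF assms(1-3,5,6)]
    using less_lambda1_iff[OF assms(1,3)] assms(5) by auto
qed (rule first_dirichlet_eigenvalue_lambda1[OF assms(1-3)])

end
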